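(* Let $(M,\langle,\rangle)$ be a connected pseudo-Riemannian weakly symmetric manifold, let $G=I(M,\langle,\rangle)^0$ be the identity component of its isometry group, and let $N$ be the nilradical of $G$. Let $H$ be the isotropy subgroup of $G$ at a base point $p\in M$, and let $\mathfrak g,\mathfrak h,\mathfrak n$ be the Lie algebras of $G,H,N$. If there is a reductive decomposition $\mathfrak g=\mathfrak m+\mathfrak h$ such that $\mathfrak n\subset\mathfrak m$ and the restriction of the metric to $[\mathfrak n,\mathfrak n]$ is positive definite or negative definite, then $N$ is at most $2$-step nilpotent.
   Context: A pseudo-Riemannian manifold $(M,\langle,\rangle)$ is a smooth manifold $M$ with a (smoothly varying, symmetric) nondegenerate inner product $\langle,\rangle$ on the fibers of its tangent bundle. An isometry of $(M,\langle,\rangle)$ is a diffeomorphism of $M$ preserving $\langle,\rangle$. $I(M,\langle,\rangle)$ is the isometry group (a Lie group in the compact-open topology) and $I(M,\langle,\rangle)^0$ its identity component. $(M,\langle,\rangle)$ is a pseudo-Riemannian weakly symmetric manifold (or space) if for every $x\in M$ and every nonzero $\xi\in T_xM$ there is an isometry $\phi=\phi_{x,\xi}$ of $(M,\langle,\rangle)$ such that $\phi(x)=x$ and $d\phi(\xi)=-\xi$. A connected such manifold is homogeneous under $G=I(M,\langle,\rangle)^0$, so $M$ is identified with $G/H$. A reductive decomposition is a vector space direct sum $\mathfrak g=\mathfrak m+\mathfrak h$ with $\mathfrak m$ an $\mathrm{Ad}(H)$-invariant subspace. The space $\mathfrak m\subset\mathfrak g=T_eG$ is identified with $T_pM$ via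 the differential of the projection $\pi:G\to G/H=M$, and through this identification $\langle,\rangle_p$ is viewed as an $\mathrm{Ad}(H)$-invariant scalar product on $\mathfrak m$; "the restriction of the metric to $[\mathfrak n,\mathfrak n]$" refers to this scalar product on $\mathfrak m\supset\mathfrak n\supset[\mathfrak n,\mathfrak n]$. "At most $2$-step nilpotent" means $[\mathfrak n,[\mathfrak n,\mathfrak n]]=0$. *)

theory Defs
  imports
    "HOL-Analysis.Analysis"
    "HOL-Library.Function_Algebras"
    "HOL-Algebra.Generated_Groups"
begin

section \<open>Pointwise real vector space structure on functions\<close>

text \<open>Tangent vectors and vector fields are functions below; with this instance the library notions
  \<^const>\<open>subspace\<close> and \<^const>\<open>span\<close> apply to them.\<close>

instantiation "fun" :: (type, real_vector) real_vector
begin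

definition scaleR_fun_def: "scaleR r f = (\<lambda>x. scaleR r (f x))"

instance
  by standard (auto simp: scaleR_fun_def fun_eq_iff scaleR_add_right scaleR_add_left)

end

lemma scaleR_fun_apply [simp]: "(scaleR r f) x = scaleR r (f x)"
  by (simp add: scaleR_fun_def)


section \<open>Smooth manifolds\<close>

text \<open>The next two definitions are meant for open \<open>S\<close> in a Euclidean space.\<close>

primrec Ck_on :: "nat \<Rightarrow> 'a::real_normed_vector set \<Rightarrow> ('a \<Rightarrow> 'b::real_normed_vector) \<Rightarrow> bool"
  where
    "Ck_on 0 S f \<longleftrightarrow> continuous_on S f"
  | "Ck_on (Suc k) S f \<longleftrightarrow>
       (\<forall>x\<in>S. f differentiable (at x)) \<and> (\<forall>v. Ck_on k S (\<lambda>x. frechet_derivative f (at x) v))"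

definition smooth_on :: "'a::real_normed_vector set \<Rightarrow> ('a \<Rightarrow> 'b::real_normed_vector) \<Rightarrow> bool"
  where "smooth_on S f \<longleftrightarrow> (\<forall>k. Ck_on k S f)"

type_synonym ('m, 'e) chart = "'m set \<times> ('m \<Rightarrow> 'e)"

text \<open>A manifold is a Hausdorff, second countable type with an atlas. The atlas need not be maximal;
  smoothness of functions and maps is tested in its charts.\<close>

definition smooth_atlas ::
  "('m::{t2_space, second_countable_topology}, 'e::euclidean_space) chart set \<Rightarrow> bool"
  where "smooth_atlas A \<longleftrightarrow>
    (\<Union>(U, c)\<in>A. U) = UNIV \<and>
    (\<forall>(U, c)\<in>A. open U \<and> open (c ` U) \<and> homeomorphism U (c ` U) c (inv_into U c)) \<and>
    (\<forall>(U, c)\<in>A. \<forall>(V, d)\<in>A. smooth_on (c ` (U \<inter> V)) (d \<circ> inv_into U c))"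

definition smooth_fun_on ::
  "('m::topological_space, 'e::euclidean_space) chart set \<Rightarrow> 'm set \<Rightarrow> ('m \<Rightarrow> real) \<Rightarrow> bool"
  where "smooth_fun_on A W f \<longleftrightarrow> (\<forall>(U, c)\<in>A. smooth_on (c ` (U \<inter> W)) (f \<circ> inv_into U c))"

definition smooth_near ::
  "('m::topological_space, 'e::euclidean_space) chart set \<Rightarrow> 'm \<Rightarrow> ('m \<Rightarrow> real) \<Rightarrow> bool"
  where "smooth_near A x f \<longleftrightarrow> (\<exists>W. open W \<and> x \<in> W \<and> smooth_fun_on A W f)"

definition smooth_map ::
  "('m::topological_space, 'e::euclidean_space) chart set \<Rightarrow> ('m \<Rightarrow> 'm) \<Rightarrow> bool"
  where "smooth_map A \<phi> \<longleftrightarrow> continuous_on UNIV \<phi> \<and>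
    (\<forall>(U, c)\<in>A. \<forall>(V, d)\<in>A. smooth_on (c ` (U \<inter> \<phi> -` V)) (d \<circ> \<phi> \<circ> inv_into U c))"

definition diffeomorphism ::
  "('m::topological_space, 'e::euclidean_space) chart set \<Rightarrow> ('m \<Rightarrow> 'm) \<Rightarrow> bool"
  where "diffeomorphism A \<phi> \<longleftrightarrow> bij \<phi> \<and> smooth_map A \<phi> \<and> smooth_map A (inv_into UNIV \<phi>)"


section \<open>Tangent vectors and vector fields\<close>

text \<open>A tangent vector at \<open>x\<close> is a first-order differential operator \<open>\<Sum>i. v\<^sub>i \<partial>/\<partial>c\<^sub>i\<close> acting on the
  functions that are smooth near \<open>x\<close>. On all other functions it takes the value 0, so that tangent
  vectors are equal iff they agree on the functions smooth near \<open>x\<close>.\<close>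

type_synonym 'm tangent = "('m \<Rightarrow> real) \<Rightarrow> real"
type_synonym 'm vector_field = "'m \<Rightarrow> 'm tangent"

definition coord_vector ::
  "('m::topological_space, 'e::euclidean_space) chart set \<Rightarrow> ('m, 'e) chart \<Rightarrow> 'e \<Rightarrow> 'm vector_field"
  where "coord_vector A = (\<lambda>(U, c) v x f.
    if smooth_near A x f then frechet_derivative (f \<circ> inv_into U c) (at (c x)) v else 0)"

definition tangent_space ::
  "('m::topological_space, 'e::euclidean_space) chart set \<Rightarrow> 'm \<Rightarrow> 'm tangent set"
  where "tangent_space A x = {coord_vector A (U, c) v x | U c v. (U, c) \<in> A \<and> x \<in> U}"

definition differential ::
  "('m::topological_space, 'e::euclidean_space) chart set \<Rightarrow> ('m \<Rightarrow> 'm) \<Rightarrow> 'm \<Rightarrow> 'm tangent \<Rightarrow> 'm tangent"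
  where "differential A \<phi> x \<xi> = (\<lambda>f. if smooth_near A (\<phi> x) f then \<xi> (f \<circ> \<phi>) else 0)"

definition smooth_vector_fields ::
  "('m::topological_space, 'e::euclidean_space) chart set \<Rightarrow> 'm vector_field set"
  where "smooth_vector_fields A = {X.
    (\<forall>x. X x \<in> tangent_space A x) \<and>
    (\<forall>x f. smooth_near A x f \<longrightarrow> smooth_near A x (\<lambda>y. X y f))}"

definition vf_bracket ::
  "('m::topological_space, 'e::euclidean_space) chart set \<Rightarrow>
   'm vector_field \<Rightarrow> 'm vector_field \<Rightarrow> 'm vector_field"
  where "vf_bracket A X Y = (\<lambda>x f.
    if smooth_near A x f then X x (\<lambda>y. Y y f) - Y x (\<lambda>y. X y f) else 0)"

definition pushforward ::
  "('m::topological_space, 'e::euclidean_space) chart set \<Rightarrow>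
   ('m \<Rightarrow> 'm) \<Rightarrow> 'm vector_field \<Rightarrow> 'm vector_field"
  where "pushforward A \<phi> X = (\<lambda>y.
    differential A \<phi> (inv_into UNIV \<phi> y) (X (inv_into UNIV \<phi> y)))"


section \<open>Pseudo-Riemannian manifolds and weak symmetry\<close>

text \<open>A metric assigns to each point a function on pairs of tangent vectors; only its values on the
  tangent space at that point matter.\<close>

type_synonym 'm metric = "'m \<Rightarrow> 'm tangent \<Rightarrow> 'm tangent \<Rightarrow> real"

definition pseudo_riemannian ::
  "('m::{t2_space, second_countable_topology}, 'e::euclidean_space) chart set \<Rightarrow> 'm metric \<Rightarrow> bool"
  where "pseudo_riemannian A g \<longleftrightarrow> smooth_atlas A \<and>
    (\<forall>x. \<forall>u\<in>tangent_space A x. \<forall>v\<in>tangent_space A x. \<forall>w\<in>tangent_space A x. \<forall>a b.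
       g x (a *\<^sub>R u + b *\<^sub>R v) w = a * g x u w + b * g x v w) \<and>
    (\<forall>x. \<forall>u\<in>tangent_space A x. \<forall>v\<in>tangent_space A x. g x u v = g x v u) \<and>
    (\<forall>x. \<forall>u\<in>tangent_space A x. (\<forall>v\<in>tangent_space A x. g x u v = 0) \<longrightarrow> u = 0) \<and>
    (\<forall>(U, c)\<in>A. \<forall>v w.
       smooth_fun_on A U (\<lambda>x. g x (coord_vector A (U, c) v x) (coord_vector A (U, c) w x)))"

definition isometries ::
  "('m::topological_space, 'e::euclidean_space) chart set \<Rightarrow> 'm metric \<Rightarrow> ('m \<Rightarrow> 'm) set"
  where "isometries A g = {\<phi>. diffeomorphism A \<phi> \<and>
    (\<forall>x. \<forall>u\<in>tangent_space A x. \<forall>v\<in>tangent_space A x.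
       g (\<phi> x) (differential A \<phi> x u) (differential A \<phi> x v) = g x u v)}"

definition weakly_symmetric ::
  "('m::{t2_space, second_countable_topology}, 'e::euclidean_space) chart set \<Rightarrow> 'm metric \<Rightarrow> bool"
  where "weakly_symmetric A g \<longleftrightarrow>
    (\<forall>x. \<forall>\<xi>\<in>tangent_space A x. \<xi> \<noteq> 0 \<longrightarrow>
       (\<exists>\<phi>\<in>isometries A g. \<phi> x = x \<and> differential A \<phi> x \<xi> = - \<xi>))"


section \<open>The isometry group as a topological group\<close>

definition compact_open_topology :: "('a::topological_space \<Rightarrow> 'b::topological_space) topology"
  where "compact_open_topology =
    topology_generated_by {{f. f ` K \<subseteq> U} | K U. compact K \<and> open U}"

text \<open>The group \<open>I(M, g)\<^sup>0\<close>.\<close>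

definition isometry_identity_component ::
  "('m::topological_space, 'e::euclidean_space) chart set \<Rightarrow> 'm metric \<Rightarrow> ('m \<Rightarrow> 'm) set"
  where "isometry_identity_component A g =
    connected_component_of_set (subtopology compact_open_topology (isometries A g)) id"

definition composition_group :: "('m \<Rightarrow> 'm) set \<Rightarrow> ('m \<Rightarrow> 'm) monoid"
  where "composition_group G = \<lparr>carrier = G, mult = (\<circ>), one = id\<rparr>"

definition isotropy_subgroup :: "('m \<Rightarrow> 'm) set \<Rightarrow> 'm \<Rightarrow> ('m \<Rightarrow> 'm) set"
  where "isotropy_subgroup G p = {\<phi>\<in>G. \<phi> p = p}"


section \<open>Lie algebras of groups of transformations\<close>

definition one_parameter_subgroup ::
  "('m::topological_space \<Rightarrow> 'm) set \<Rightarrow> (real \<Rightarrow> 'm \<Rightarrow> 'm) \<Rightarrow> bool"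
  where "one_parameter_subgroup K \<gamma> \<longleftrightarrow>
    continuous_map euclideanreal (subtopology compact_open_topology K) \<gamma> \<and>
    (\<forall>s t. \<gamma> (s + t) = \<gamma> s \<circ> \<gamma> t) \<and> \<gamma> 0 = id"

definition infinitesimal_generator ::
  "('m::topological_space, 'e::euclidean_space) chart set \<Rightarrow>
   (real \<Rightarrow> 'm \<Rightarrow> 'm) \<Rightarrow> 'm vector_field \<Rightarrow> bool"
  where "infinitesimal_generator A \<gamma> X \<longleftrightarrow>
    (\<forall>x f. smooth_near A x f \<longrightarrow> ((\<lambda>t. f (\<gamma> t x)) has_real_derivative X x f) (at 0))"

text \<open>The Lie algebra of a Lie group \<open>K\<close> acting effectively on the manifold, an element being
  represented by the fundamental vector field \<open>x \<mapsto> d/dt exp(t X) x\<close> (at \<open>t = 0\<close>) of its one-parameter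
  subgroup \<open>exp(t X)\<close>. In this representation
  \<^item> the differential at the identity of the orbit map \<open>\<phi> \<mapsto> \<phi> p\<close> is evaluation \<open>X \<mapsto> X p\<close>;
  \<^item> \<open>Ad \<phi>\<close> is \<open>pushforward A \<phi>\<close>, since \<open>\<phi> \<circ> exp(t X) \<circ> \<phi>\<^sup>-\<^sup>1\<close> generates that field;
  \<^item> as usual for left actions, the Lie bracket of the group is the negative of the bracket of
    vector fields.\<close>

definition lie_algebra ::
  "('m::topological_space, 'e::euclidean_space) chart set \<Rightarrow> ('m \<Rightarrow> 'm) set \<Rightarrow> 'm vector_field set"
  where "lie_algebra A K = {X \<in> smooth_vector_fields A.
    \<exists>\<gamma>. one_parameter_subgroup K \<gamma> \<and> infinitesimal_generator A \<gamma> X}"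

definition lie_bracket ::
  "('m::topological_space, 'e::euclidean_space) chart set \<Rightarrow>
   'm vector_field \<Rightarrow> 'm vector_field \<Rightarrow> 'm vector_field"
  where "lie_bracket A X Y = - vf_bracket A X Y"

text \<open>\<open>[P, Q]\<close>, the linear span of all brackets.\<close>

definition bracket_space ::
  "('m::topological_space, 'e::euclidean_space) chart set \<Rightarrow>
   'm vector_field set \<Rightarrow> 'm vector_field set \<Rightarrow> 'm vector_field set"
  where "bracket_space A P Q = span {lie_bracket A X Y | X Y. X \<in> P \<and> Y \<in> Q}"

definition lie_subalgebra ::
  "('m::topological_space, 'e::euclidean_space) chart set \<Rightarrow> 'm vector_field set \<Rightarrow> bool"
  where "lie_subalgebra A L \<longleftrightarrow> subspace L \<and> (\<forall>X\<in>L. \<forall>Y\<in>L. lie_bracket A X Y \<in> L)"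

primrec lower_central_series ::
  "('m::topological_space, 'e::euclidean_space) chart set \<Rightarrow> 'm vector_field set \<Rightarrow> nat \<Rightarrow>
   'm vector_field set"
  where
    "lower_central_series A L 0 = L"
  | "lower_central_series A L (Suc k) = bracket_space A L (lower_central_series A L k)"

definition nilpotent_lie_algebra ::
  "('m::topological_space, 'e::euclidean_space) chart set \<Rightarrow> 'm vector_field set \<Rightarrow> bool"
  where "nilpotent_lie_algebra A L \<longleftrightarrow> (\<exists>k. lower_central_series A L k = {0})"

text \<open>Connected Lie subgroups, in the sense of analytic (not necessarily closed) subgroups: the
  subgroups generated by the one-parameter subgroups of a Lie subalgebra.\<close>

definition connected_lie_subgroup ::
  "('m::topological_space, 'e::euclidean_space) chart set \<Rightarrow> ('m \<Rightarrow> 'm) set \<Rightarrow> ('m \<Rightarrow> 'm) set \<Rightarrow> bool"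
  where "connected_lie_subgroup A G K \<longleftrightarrow>
    subgroup K (composition_group G) \<and>
    lie_subalgebra A (lie_algebra A K) \<and>
    K = generate (composition_group G) {\<gamma> t | \<gamma> t. one_parameter_subgroup K \<gamma>}"

text \<open>The nilradical of \<open>G\<close>: its largest connected nilpotent normal Lie subgroup. As usual, a
  connected Lie group is called nilpotent if its Lie algebra is nilpotent.\<close>

definition connected_nilpotent_normal ::
  "('m::topological_space, 'e::euclidean_space) chart set \<Rightarrow> ('m \<Rightarrow> 'm) set \<Rightarrow> ('m \<Rightarrow> 'm) set \<Rightarrow> bool"
  where "connected_nilpotent_normal A G K \<longleftrightarrow>
    connected_lie_subgroup A G K \<and>
    normal K (composition_group G) \<and>
    nilpotent_lie_algebra A (lie_algebra A K)"

definition is_nilradical ::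
  "('m::topological_space, 'e::euclidean_space) chart set \<Rightarrow> ('m \<Rightarrow> 'm) set \<Rightarrow> ('m \<Rightarrow> 'm) set \<Rightarrow> bool"
  where "is_nilradical A G N \<longleftrightarrow>
    connected_nilpotent_normal A G N \<and>
    (\<forall>K. connected_nilpotent_normal A G K \<longrightarrow> K \<subseteq> N)"

end

theory Submission
  imports Defs
begin

text \<open>
  The argument reduces the theorem to a statement about the Lie algebra \<open>\<nn>\<close> and the metric at the
  single point \<open>p\<close>.

  A field of \<open>\<gg>\<close> that vanishes at \<open>p\<close> generates a flow fixing \<open>p\<close> (\<open>flow_fixes_zero\<close>), so it lies in
  \<open>\<hh>\<close>. Since \<open>\<nn> \<subseteq> \<mm>\<close> and \<open>\<mm> \<inter> \<hh> = 0\<close>, evaluation at \<open>p\<close> is injective on \<open>\<nn>\<close>; this makes \<open>\<nn>\<close> finite-dimensional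
  and pulls the metric at \<open>p\<close> back to a symmetric form \<open>q\<close> on it. An isometry \<open>\<phi>\<close> fixing \<open>p\<close> normalizes the
  identity component \<open>G\<close>, and by the maximality of the nilradical it normalizes \<open>N\<close>
  (\<open>pushforward_nilradical\<close>). Its push-forward is thus an automorphism of \<open>\<nn>\<close> that preserves \<open>q\<close>.
  If \<open>\<phi>\<close> reverses the tangent vector \<open>X p\<close> of some \<open>X \<in> \<nn>\<close>, then injectivity of the evaluation shows that it
  reverses the field \<open>X\<close>. By weak symmetry, every element of \<open>\<nn>\<close> is therefore reversed by some
  \<open>q\<close>-preserving automorphism of \<open>\<nn>\<close>.

  The rest is algebra. Let \<open>\<nn>' = [\<nn>, \<nn>]\<close> and let \<open>\<aa>\<close> be its orthogonal complement in \<open>\<nn>\<close>; as \<open>q\<close> is definite on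
  \<open>\<nn>'\<close>, \<open>\<nn> = \<aa> + \<nn>'\<close>. Given \<open>x \<in> \<nn>'\<close> and \<open>y \<in> \<aa>\<close>, an automorphism \<open>\<phi>\<close> reversing \<open>x + y\<close> reverses both
  summands, so it fixes \<open>[y, x]\<close> and \<open>q [y, x] x = q (\<phi> [y, x]) (\<phi> x) = - q [y, x] x\<close>
  (\<open>bracket_orthogonal_of_reversing\<close>). Hence the restriction of \<open>ad y\<close> to \<open>\<nn>'\<close> is skew for a definite form;
  being nilpotent, it is zero (\<open>skew_nilpotent_eq_zero\<close>). So \<open>\<aa>\<close> centralizes \<open>\<nn>'\<close>, and as a
  complement of \<open>\<nn>'\<close> generates the nilpotent algebra \<open>\<nn>\<close>, all of \<open>\<nn>\<close> centralizes \<open>\<nn>'\<close>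
  (\<open>two_step_nilpotent\<close>).
\<close>

section \<open>Calculus of \<open>C\<^sup>k\<close> functions\<close>

lemma Ck_on_subset: "Ck_on k S f \<Longrightarrow> T \<subseteq> S \<Longrightarrow> Ck_on k T f"
  by (induction k arbitrary: f) (auto intro: continuous_on_subset)

lemma Ck_on_cong:
  assumes "Ck_on k S f" "open S" "\<And>x. x \<in> S \<Longrightarrow> f x = g x"
  shows "Ck_on k S g"
  using assms
proof (induction k arbitrary: f g)
  case 0
  then show ?case by (auto cong: continuous_on_cong)
next
  case (Suc k)
  have fg: "frechet_derivative f (at x) = frechet_derivative g (at x)" if "x \<in> S" for x
    using Suc.prems that by (intro frechet_derivative_transform_within_open[of f x S]) auto
  have "g differentiable (at x)" if "x \<in> S" for x
  proof -
    have "f differentiable (at x)"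
      using Suc.prems that by auto
    then show ?thesis
      unfolding differentiable_def
      using has_derivative_transform_within_open[of f _ x UNIV S g] Suc.prems that by auto
  qed
  moreover have "Ck_on k S (\<lambda>x. frechet_derivative g (at x) v)" for v
    by (rule Suc.IH[of "\<lambda>x. frechet_derivative f (at x) v"]) (use Suc.prems fg in auto)
  ultimately show ?case by simp
qed

lemma Ck_on_local:
  assumes "\<And>x. x \<in> S \<Longrightarrow> \<exists>T. open T \<and> x \<in> T \<and> Ck_on k T f"
  shows "Ck_on k S f"
  using assms
proof (induction k arbitrary: f)
  case 0
  have "continuous (at x) f" if "x \<in> S" for x
    using 0[OF that] by (auto simp: continuous_on_eq_continuous_at)
  then show ?case
    by (simp add: continuous_at_imp_continuous_on)
next
  case (Suc k)
  have "f differentiable (at x)" if "x \<in> S" for x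
    using Suc.prems[OF that] by auto
  moreover have "Ck_on k S (\<lambda>x. frechet_derivative f (at x) v)" for v
    by (rule Suc.IH) (use Suc.prems in fastforce)
  ultimately show ?case by simp
qed

lemma Ck_on_SucD: "Ck_on (Suc k) S f \<Longrightarrow> Ck_on k S f"
proof (induction k arbitrary: f)
  case 0
  then show ?case
    by (auto intro!: continuous_at_imp_continuous_on differentiable_imp_continuous_within)
next
  case (Suc k)
  have "Ck_on k S (\<lambda>x. frechet_derivative f (at x) v)" for v
    using Suc.prems by (intro Suc.IH) (simp only: Ck_on.simps(2)[of "Suc k"])
  then show ?case
    using Suc.prems by simp
qed

lemma Ck_on_const: "Ck_on k S (\<lambda>x. c)"
  by (induction k arbitrary: c) auto

lemma Ck_on_bounded_linear:
  assumes "bounded_linear L" "open S" "Ck_on k S f"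
  shows "Ck_on k S (\<lambda>x. L (f x))"
  using assms(3)
proof (induction k arbitrary: f)
  case 0
  then show ?case
    using assms(1) by (auto intro: bounded_linear.continuous_on)
next
  case (Suc k)
  have D: "((\<lambda>x. L (f x)) has_derivative (\<lambda>v. L (frechet_derivative f (at x) v))) (at x)"
    if "x \<in> S" for x
    using Suc.prems that
    by (intro bounded_linear.has_derivative[OF assms(1)]) (simp add: frechet_derivative_works[symmetric])
  have "Ck_on k S (\<lambda>x. frechet_derivative (\<lambda>x. L (f x)) (at x) v)" for v
    by (rule Ck_on_cong[of k S "\<lambda>x. L (frechet_derivative f (at x) v)"])
      (use Suc.prems frechet_derivative_at[OF D] assms(2) in \<open>auto intro!: Suc.IH dest: fun_cong\<close>)
  then show ?case
    using D by (auto simp: differentiable_def)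
qed

lemma Ck_on_add:
  assumes "open S" "Ck_on k S f" "Ck_on k S g"
  shows "Ck_on k S (\<lambda>x. f x + g x)"
  using assms(2,3)
proof (induction k arbitrary: f g)
  case 0
  then show ?case
    by (simp add: continuous_on_add)
next
  case (Suc k)
  have D: "((\<lambda>x. f x + g x) has_derivative
      (\<lambda>v. frechet_derivative f (at x) v + frechet_derivative g (at x) v)) (at x)"
    if "x \<in> S" for x
    using Suc.prems that
    by (intro has_derivative_add) (simp_all add: frechet_derivative_works[symmetric])
  have "Ck_on k S (\<lambda>x. frechet_derivative (\<lambda>x. f x + g x) (at x) v)" for v
    by (rule Ck_on_cong[of k S "\<lambda>x. frechet_derivative f (at x) v + frechet_derivative g (at x) v"])
      (use Suc.prems frechet_derivative_at[OF D] assms(1) in \<open>auto intro!: Suc.IH dest: fun_cong\<close>)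
  then show ?case
    using D by (auto simp: differentiable_def)
qed

lemma Ck_on_sum:
  assumes "open S" "\<And>i. i \<in> I \<Longrightarrow> Ck_on k S (f i)"
  shows "Ck_on k S (\<lambda>x. \<Sum>i\<in>I. f i x)"
  using assms(2)
  by (induction I rule: infinite_finite_induct) (auto intro: Ck_on_const Ck_on_add[OF assms(1)])

lemma Ck_on_scaleR:
  assumes "open S" "Ck_on k S f" "Ck_on k S g"
  shows "Ck_on k S (\<lambda>x. f x *\<^sub>R g x)"
  using assms(2,3)
proof (induction k arbitrary: f g)
  case 0
  then show ?case
    by (simp add: continuous_on_scaleR)
next
  case (Suc k)
  have D: "((\<lambda>x. f x *\<^sub>R g x) has_derivative
      (\<lambda>v. f x *\<^sub>R frechet_derivative g (at x) v + frechet_derivative f (at x) v *\<^sub>R g x)) (at x)"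
    if "x \<in> S" for x
    using Suc.prems that
    by (intro has_derivative_scaleR) (simp_all add: frechet_derivative_works[symmetric])
  have "Ck_on k S (\<lambda>x. frechet_derivative (\<lambda>x. f x *\<^sub>R g x) (at x) v)" for v
  proof (rule Ck_on_cong[OF _ assms(1)])
    show "Ck_on k S (\<lambda>x. f x *\<^sub>R frechet_derivative g (at x) v +
        frechet_derivative f (at x) v *\<^sub>R g x)"
      using Suc.prems[THEN Ck_on_SucD] Suc.prems by (intro Ck_on_add assms(1) Suc.IH) simp_all
  qed (use frechet_derivative_at[OF D] in \<open>auto dest: fun_cong\<close>)
  then show ?case
    using D by (auto simp: differentiable_def)
qed

text \<open>The chain rule expresses the partial derivatives of \<open>g \<circ> f\<close> as finite sums, over a basis of
  the middle space, of products of functions of the same kind with one order of smoothness less;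
  this is why the middle space is Euclidean.\<close>

lemma Ck_on_compose:
  fixes f :: "'a::real_normed_vector \<Rightarrow> 'b::euclidean_space"
    and g :: "'b \<Rightarrow> 'c::real_normed_vector"
  assumes "open S" "open T" "f ` S \<subseteq> T" "Ck_on k S f" "Ck_on k T g"
  shows "Ck_on k S (g \<circ> f)"
  using assms(4,5)
proof (induction k arbitrary: g)
  case 0
  then show ?case
    using assms(3) by (auto simp del: o_apply intro!: continuous_on_compose elim: continuous_on_subset)
next
  case (Suc k)
  have gd: "g differentiable (at (f x))" and fd: "f differentiable (at x)" if "x \<in> S" for x
    using Suc.prems assms(3) that by auto
  have D: "(g \<circ> f has_derivative frechet_derivative g (at (f x)) \<circ> frechet_derivative f (at x)) (at x)"
    if "x \<in> S" for x
    using gd[OF that] fd[OF that] by (intro diff_chain_at) (simp_all add: frechet_derivative_works[symmetric])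
  have E: "(\<Sum>b\<in>Basis. (frechet_derivative f (at x) v \<bullet> b) *\<^sub>R ((\<lambda>y. frechet_derivative g (at y) b) \<circ> f) x) =
      frechet_derivative (g \<circ> f) (at x) v" if "x \<in> S" for x v
  proof -
    have "frechet_derivative (g \<circ> f) (at x) v =
        frechet_derivative g (at (f x)) (\<Sum>b\<in>Basis. (frechet_derivative f (at x) v \<bullet> b) *\<^sub>R b)"
      using frechet_derivative_at[OF D[OF that]] by (simp add: fun_eq_iff euclidean_representation)
    also have "\<dots> = (\<Sum>b\<in>Basis. (frechet_derivative f (at x) v \<bullet> b) *\<^sub>R frechet_derivative g (at (f x)) b)"
      using linear_frechet_derivative[OF gd[OF that]] by (simp add: linear_sum linear_scale)
    finally show ?thesis by simp
  qed
  have "Ck_on k S (\<lambda>x. frechet_derivative (g \<circ> f) (at x) v)" for v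
  proof (rule Ck_on_cong[OF _ assms(1) E])
    have "Ck_on k S ((\<lambda>y. frechet_derivative g (at y) b) \<circ> f)" for b
      by (rule Suc.IH[OF Ck_on_SucD[OF Suc.prems(1)]]) (use Suc.prems(2) in simp)
    moreover have "Ck_on k S (\<lambda>x. frechet_derivative f (at x) v \<bullet> b)" for b
      using Suc.prems by (intro Ck_on_bounded_linear[OF bounded_linear_inner_left assms(1)]) simp
    ultimately show "Ck_on k S (\<lambda>x. \<Sum>b\<in>Basis. (frechet_derivative f (at x) v \<bullet> b) *\<^sub>R
        ((\<lambda>y. frechet_derivative g (at y) b) \<circ> f) x)"
      using assms(1) by (intro Ck_on_sum Ck_on_scaleR)
  qed
  then show ?case
    using D unfolding Ck_on.simps differentiable_def by blast
qed

lemma smooth_on_subset: "smooth_on S f \<Longrightarrow> T \<subseteq> S \<Longrightarrow> smooth_on T f"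
  unfolding smooth_on_def by (blast intro: Ck_on_subset)

lemma smooth_on_cong:
  "smooth_on S f \<Longrightarrow> open S \<Longrightarrow> (\<And>x. x \<in> S \<Longrightarrow> f x = g x) \<Longrightarrow> smooth_on S g"
  unfolding smooth_on_def by (metis Ck_on_cong)

lemma smooth_on_local:
  "(\<And>x. x \<in> S \<Longrightarrow> \<exists>T. open T \<and> x \<in> T \<and> smooth_on T f) \<Longrightarrow> smooth_on S f"
  unfolding smooth_on_def by (meson Ck_on_local)

lemma smooth_on_compose:
  fixes f :: "'a::real_normed_vector \<Rightarrow> 'b::euclidean_space"
  shows "smooth_on S f \<Longrightarrow> smooth_on T g \<Longrightarrow> open S \<Longrightarrow> open T \<Longrightarrow> f ` S \<subseteq> T \<Longrightarrow> smooth_on S (g \<circ> f)"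
  unfolding smooth_on_def by (blast intro: Ck_on_compose)

lemma smooth_on_add: "smooth_on S f \<Longrightarrow> smooth_on S g \<Longrightarrow> open S \<Longrightarrow> smooth_on S (\<lambda>x. f x + g x)"
  unfolding smooth_on_def by (blast intro: Ck_on_add)

lemma smooth_on_bounded_linear:
  "bounded_linear L \<Longrightarrow> smooth_on S f \<Longrightarrow> open S \<Longrightarrow> smooth_on S (\<lambda>x. L (f x))"
  unfolding smooth_on_def by (blast intro: Ck_on_bounded_linear)

lemma smooth_on_differentiable: "smooth_on S f \<Longrightarrow> x \<in> S \<Longrightarrow> f differentiable (at x)"
  unfolding smooth_on_def by (metis Ck_on.simps(2))

section \<open>Smooth functions and tangent vectors in charts\<close>

locale manifold =
  fixes A :: "('m::{t2_space, second_countable_topology}, 'e::euclidean_space) chart set"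
  assumes smooth_atlas: "smooth_atlas A"
begin

lemma chart_at: obtains U c where "(U, c) \<in> A" "x \<in> U"
proof -
  have "(\<Union>(U, c)\<in>A. U) = UNIV"
    using smooth_atlas by (simp add: smooth_atlas_def)
  then show ?thesis
    using that UNIV_I[of x] by (metis (no_types, lifting) UN_E case_prod_unfold prod.collapse)
qed

lemma
  assumes "(U, c) \<in> A"
  shows open_chart: "open U" and open_chart_range: "open (c ` U)"
    and homeomorphism_chart: "homeomorphism U (c ` U) c (inv_into U c)"
  using smooth_atlas assms unfolding smooth_atlas_def by blast+

lemma inv_chart: "(U, c) \<in> A \<Longrightarrow> x \<in> U \<Longrightarrow> inv_into U c (c x) = x"
  using homeomorphism_chart by (auto simp: homeomorphism_def)

lemma open_chart_image:
  assumes "(U, c) \<in> A" "open W"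
  shows "open (c ` (U \<inter> W))"
proof -
  have "c ` (U \<inter> W) = c ` U \<inter> inv_into U c -` W"
    using inv_chart[OF assms(1)] by force
  moreover have "continuous_on (c ` U) (inv_into U c)"
    using homeomorphism_chart[OF assms(1)] by (simp add: homeomorphism_def)
  ultimately show ?thesis
    using continuous_open_preimage open_chart_range assms by metis
qed

lemma open_chart_image': "(U, c) \<in> A \<Longrightarrow> open W \<Longrightarrow> W \<subseteq> U \<Longrightarrow> open (c ` W)"
  using open_chart_image[of U c W] by (simp add: inf_absorb2)

lemma smooth_transition:
  "(U, c) \<in> A \<Longrightarrow> (V, d) \<in> A \<Longrightarrow> smooth_on (c ` (U \<inter> V)) (d \<circ> inv_into U c)"
  using smooth_atlas unfolding smooth_atlas_def by blast

text \<open>Since transition maps are smooth, smoothness near a point can be tested in one chart.\<close>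

lemma smooth_near_iff_chart:
  assumes "(U, c) \<in> A" "x \<in> U"
  shows "smooth_near A x f \<longleftrightarrow>
    (\<exists>W. open W \<and> x \<in> W \<and> W \<subseteq> U \<and> smooth_on (c ` W) (f \<circ> inv_into U c))"
proof
  assume "smooth_near A x f"
  then obtain W where W: "open W" "x \<in> W" "smooth_fun_on A W f"
    unfolding smooth_near_def by blast
  then have "smooth_on (c ` (U \<inter> W)) (f \<circ> inv_into U c)"
    using assms unfolding smooth_fun_on_def by blast
  then show "\<exists>W. open W \<and> x \<in> W \<and> W \<subseteq> U \<and> smooth_on (c ` W) (f \<circ> inv_into U c)"
    using W assms open_chart by (intro exI[of _ "U \<inter> W"]) auto
next
  assume "\<exists>W. open W \<and> x \<in> W \<and> W \<subseteq> U \<and> smooth_on (c ` W) (f \<circ> inv_into U c)"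
  then obtain W where W: "open W" "x \<in> W" "W \<subseteq> U" "smooth_on (c ` W) (f \<circ> inv_into U c)"
    by blast
  have "smooth_on (d ` (V \<inter> W)) (f \<circ> inv_into V d)" if V: "(V, d) \<in> A" for V d
  proof (rule smooth_on_cong)
    show op: "open (d ` (V \<inter> W))"
      using V W by (intro open_chart_image)
    show "smooth_on (d ` (V \<inter> W)) ((f \<circ> inv_into U c) \<circ> (c \<circ> inv_into V d))"
    proof (rule smooth_on_compose[OF _ W(4) op])
      show "smooth_on (d ` (V \<inter> W)) (c \<circ> inv_into V d)"
        using smooth_transition[OF V assms(1)] W by (rule_tac smooth_on_subset) auto
      show "open (c ` W)"
        using open_chart_image'[OF assms(1) W(1,3)] .
    qed (auto simp: inv_chart[OF V])
    show "((f \<circ> inv_into U c) \<circ> (c \<circ> inv_into V d)) y = (f \<circ> inv_into V d) y"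
      if "y \<in> d ` (V \<inter> W)" for y
      using that W by (auto simp: inv_chart[OF V] inv_chart[OF assms(1)] subset_iff)
  qed
  then show "smooth_near A x f"
    using W unfolding smooth_near_def smooth_fun_on_def by blast
qed

lemma smooth_near_cong:
  assumes "smooth_near A x f" "open W" "x \<in> W" "\<And>y. y \<in> W \<Longrightarrow> f y = g y"
  shows "smooth_near A x g"
proof -
  obtain U c where c: "(U, c) \<in> A" "x \<in> U"
    by (rule chart_at)
  obtain W' where W': "open W'" "x \<in> W'" "W' \<subseteq> U" "smooth_on (c ` W') (f \<circ> inv_into U c)"
    using assms(1) smooth_near_iff_chart[OF c] by blast
  have "smooth_on (c ` (W \<inter> W')) (g \<circ> inv_into U c)"
  proof (rule smooth_on_cong)
    show "smooth_on (c ` (W \<inter> W')) (f \<circ> inv_into U c)"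
      using W'(4) by (rule smooth_on_subset) auto
    show "open (c ` (W \<inter> W'))"
      using open_chart_image'[OF c(1) open_Int[OF assms(2) W'(1)]] W'(3) by auto
    show "(f \<circ> inv_into U c) y = (g \<circ> inv_into U c) y" if "y \<in> c ` (W \<inter> W')" for y
      using that W'(3) assms(4) inv_chart[OF c(1)] by force
  qed
  then show ?thesis
    unfolding smooth_near_iff_chart[OF c] using W' assms(2,3)
    by (intro exI[of _ "W \<inter> W'"]) auto
qed

lemma smooth_near_nhd:
  assumes "smooth_near A x f"
  obtains W where "open W" "x \<in> W" "\<And>y. y \<in> W \<Longrightarrow> smooth_near A y f"
  using assms unfolding smooth_near_def by blast

lemma smooth_near_add:
  assumes "smooth_near A x f" "smooth_near A x g"
  shows "smooth_near A x (\<lambda>y. f y + g y)"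
proof -
  obtain U c where c: "(U, c) \<in> A" "x \<in> U"
    by (rule chart_at)
  obtain W where W: "open W" "x \<in> W" "W \<subseteq> U" "smooth_on (c ` W) (f \<circ> inv_into U c)"
    using assms(1) smooth_near_iff_chart[OF c] by blast
  obtain W' where W': "open W'" "x \<in> W'" "W' \<subseteq> U" "smooth_on (c ` W') (g \<circ> inv_into U c)"
    using assms(2) smooth_near_iff_chart[OF c] by blast
  have "smooth_on (c ` (W \<inter> W')) (\<lambda>z. (f \<circ> inv_into U c) z + (g \<circ> inv_into U c) z)"
  proof (rule smooth_on_add)
    show "open (c ` (W \<inter> W'))"
      using open_chart_image'[OF c(1) open_Int[OF W(1) W'(1)]] W(3) by auto
  qed (use W(4) W'(4) in \<open>auto simp del: o_apply elim: smooth_on_subset\<close>)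
  then show ?thesis
    unfolding smooth_near_iff_chart[OF c] using W W'
    by (intro exI[of _ "W \<inter> W'"]) (auto simp: comp_def)
qed

lemma smooth_near_minus:
  assumes "smooth_near A x f"
  shows "smooth_near A x (\<lambda>y. - f y)"
proof -
  obtain U c where c: "(U, c) \<in> A" "x \<in> U"
    by (rule chart_at)
  obtain W where W: "open W" "x \<in> W" "W \<subseteq> U" "smooth_on (c ` W) (f \<circ> inv_into U c)"
    using assms(1) smooth_near_iff_chart[OF c] by blast
  have "smooth_on (c ` W) (\<lambda>z. - (f \<circ> inv_into U c) z)"
    using W open_chart_image'[OF c(1)]
    by (intro smooth_on_bounded_linear[of uminus] bounded_linear_minus bounded_linear_ident)
      (auto simp del: o_apply)
  then show ?thesis
    unfolding smooth_near_iff_chart[OF c] using W by (auto simp: comp_def)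
qed

lemma smooth_near_coordinate:
  assumes c: "(U, c) \<in> A" "x \<in> U" and "bounded_linear L"
  shows "smooth_near A x (\<lambda>y. L (c y))"
proof -
  have "smooth_on (c ` U) (\<lambda>z. L ((c \<circ> inv_into U c) z))"
    using smooth_transition[OF c(1) c(1)] open_chart_range[OF c(1)]
    by (intro smooth_on_bounded_linear[OF assms(3)]) (simp_all del: o_apply)
  then show ?thesis
    unfolding smooth_near_iff_chart[OF c] using c(2) open_chart[OF c(1)]
    by (intro exI[of _ U]) (simp add: comp_def)
qed

lemma smooth_near_differentiable:
  assumes "(U, c) \<in> A" "x \<in> U" "smooth_near A x f"
  shows "(f \<circ> inv_into U c) differentiable (at (c x))"
  using assms(3) smooth_on_differentiable unfolding smooth_near_iff_chart[OF assms(1,2)] by blast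

lemma coord_vector_apply:
  "coord_vector A (U, c) v x f =
    (if smooth_near A x f then frechet_derivative (f \<circ> inv_into U c) (at (c x)) v else 0)"
  by (simp add: coord_vector_def)

lemma tangent_spaceE:
  assumes "X \<in> tangent_space A x"
  obtains U c v where "(U, c) \<in> A" "x \<in> U" "X = coord_vector A (U, c) v x"
  using assms unfolding tangent_space_def by blast

lemma coord_vector_tangent:
  "(U, c) \<in> A \<Longrightarrow> x \<in> U \<Longrightarrow> coord_vector A (U, c) v x \<in> tangent_space A x"
  unfolding tangent_space_def by blast

lemma tangent_not_smooth: "X \<in> tangent_space A x \<Longrightarrow> \<not> smooth_near A x f \<Longrightarrow> X f = 0"
  by (auto elim!: tangent_spaceE simp: coord_vector_apply)

lemma tangent_add:
  assumes "X \<in> tangent_space A x" "smooth_near A x f" "smooth_near A x g"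
  shows "X (\<lambda>y. f y + g y) = X f + X g"
proof -
  obtain U c v where c: "(U, c) \<in> A" "x \<in> U" "X = coord_vector A (U, c) v x"
    using assms(1) by (rule tangent_spaceE)
  have "((\<lambda>z. (f \<circ> inv_into U c) z + (g \<circ> inv_into U c) z) has_derivative
      (\<lambda>v. frechet_derivative (f \<circ> inv_into U c) (at (c x)) v +
           frechet_derivative (g \<circ> inv_into U c) (at (c x)) v)) (at (c x))"
    using assms(2,3) smooth_near_differentiable[OF c(1,2)]
    by (intro has_derivative_add) (simp_all add: frechet_derivative_works[symmetric] del: o_apply)
  from fun_cong[OF frechet_derivative_at[OF this], of v] show ?thesis
    using assms(2,3) smooth_near_add by (simp add: c(3) coord_vector_apply comp_def)
qed

lemma tangent_minus:
  assumes "X \<in> tangent_space A x" "smooth_near A x f"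
  shows "X (\<lambda>y. - f y) = - X f"
proof -
  obtain U c v where c: "(U, c) \<in> A" "x \<in> U" "X = coord_vector A (U, c) v x"
    using assms(1) by (rule tangent_spaceE)
  have "((\<lambda>z. - (f \<circ> inv_into U c) z) has_derivative
      (\<lambda>v. - frechet_derivative (f \<circ> inv_into U c) (at (c x)) v)) (at (c x))"
    using assms(2) smooth_near_differentiable[OF c(1,2)]
    by (intro has_derivative_minus) (simp add: frechet_derivative_works[symmetric] del: o_apply)
  from fun_cong[OF frechet_derivative_at[OF this], of v] show ?thesis
    using assms(2) smooth_near_minus by (simp add: c(3) coord_vector_apply comp_def)
qed

lemma tangent_diff:
  assumes "X \<in> tangent_space A x" "smooth_near A x f" "smooth_near A x g"
  shows "X (\<lambda>y. f y - g y) = X f - X g"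
  using tangent_add[OF assms(1,2) smooth_near_minus[OF assms(3)]] tangent_minus[OF assms(1,3)]
  by simp

lemma smooth_near_scaleR:
  assumes "smooth_near A x f"
  shows "smooth_near A x (\<lambda>y. r * f y)"
proof -
  obtain U c where c: "(U, c) \<in> A" "x \<in> U"
    by (rule chart_at)
  obtain W where W: "open W" "x \<in> W" "W \<subseteq> U" "smooth_on (c ` W) (f \<circ> inv_into U c)"
    using assms(1) smooth_near_iff_chart[OF c] by blast
  have "smooth_on (c ` W) (\<lambda>z. r * (f \<circ> inv_into U c) z)"
    using W open_chart_image'[OF c(1)]
    by (intro smooth_on_bounded_linear[of "(*) r"] bounded_linear_mult_right)
      (auto simp del: o_apply)
  then show ?thesis
    unfolding smooth_near_iff_chart[OF c] using W by (auto simp: comp_def)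
qed

lemma tangent_scale:
  assumes "X \<in> tangent_space A x" "smooth_near A x f"
  shows "X (\<lambda>y. r * f y) = r * X f"
proof -
  obtain U c v where c: "(U, c) \<in> A" "x \<in> U" "X = coord_vector A (U, c) v x"
    using assms(1) by (rule tangent_spaceE)
  have "((\<lambda>z. r * (f \<circ> inv_into U c) z) has_derivative
      (\<lambda>v. r * frechet_derivative (f \<circ> inv_into U c) (at (c x)) v)) (at (c x))"
    using assms(2) smooth_near_differentiable[OF c(1,2)]
    by (intro has_derivative_mult_right) (simp add: frechet_derivative_works[symmetric] del: o_apply)
  from fun_cong[OF frechet_derivative_at[OF this], of v] show ?thesis
    using assms(2) smooth_near_scaleR by (simp add: c(3) coord_vector_apply comp_def)
qed

text \<open>If one of \<open>f\<close> and \<open>g\<close> is not smooth near \<open>x\<close>, then neither is the other, and both sides take the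
  default value 0.\<close>

lemma tangent_local:
  assumes "X \<in> tangent_space A x" "open W" "x \<in> W" "\<And>y. y \<in> W \<Longrightarrow> f y = g y"
  shows "X f = X g"
proof (cases "smooth_near A x f")
  case True
  obtain U c v where c: "(U, c) \<in> A" "x \<in> U" "X = coord_vector A (U, c) v x"
    using assms(1) by (rule tangent_spaceE)
  have "frechet_derivative (f \<circ> inv_into U c) (at (c x)) =
      frechet_derivative (g \<circ> inv_into U c) (at (c x))"
  proof (rule frechet_derivative_transform_within_open)
    show "(f \<circ> inv_into U c) y = (g \<circ> inv_into U c) y" if "y \<in> c ` (U \<inter> W)" for y
      using that assms(4) by (auto simp: inv_chart[OF c(1)])
  qed (use c assms True smooth_near_differentiable open_chart_image in auto)
  moreover have "smooth_near A x g"
    using smooth_near_cong[OF True] assms by blast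
  ultimately show ?thesis
    using True by (simp add: c(3) coord_vector_apply)
next
  case False
  then have "\<not> smooth_near A x g"
    using smooth_near_cong[of x g W f] assms by metis
  then show ?thesis
    using False tangent_not_smooth[OF assms(1)] by simp
qed

section \<open>Smooth maps and their differentials\<close>

lemma smooth_mapD:
  assumes "smooth_map A \<phi>"
  shows "(U, c) \<in> A \<Longrightarrow> (V, d) \<in> A \<Longrightarrow> smooth_on (c ` (U \<inter> \<phi> -` V)) (d \<circ> \<phi> \<circ> inv_into U c)"
    and "open W \<Longrightarrow> open (\<phi> -` W)"
  using assms unfolding smooth_map_def by (blast, metis open_vimage)

lemma smooth_map_near:
  assumes "smooth_map A \<phi>" "smooth_near A (\<phi> x) f"
  shows "smooth_near A x (f \<circ> \<phi>)"
proof -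
  obtain U c where c: "(U, c) \<in> A" "x \<in> U"
    by (rule chart_at)
  obtain V d where d: "(V, d) \<in> A" "\<phi> x \<in> V"
    by (rule chart_at)
  obtain W where W: "open W" "\<phi> x \<in> W" "W \<subseteq> V" "smooth_on (d ` W) (f \<circ> inv_into V d)"
    using assms(2) smooth_near_iff_chart[OF d] by blast
  have "smooth_on (c ` (U \<inter> \<phi> -` W)) (f \<circ> \<phi> \<circ> inv_into U c)"
  proof (rule smooth_on_cong)
    show op: "open (c ` (U \<inter> \<phi> -` W))"
      using c smooth_mapD(2)[OF assms(1) W(1)] by (intro open_chart_image)
    show "smooth_on (c ` (U \<inter> \<phi> -` W)) ((f \<circ> inv_into V d) \<circ> (d \<circ> \<phi> \<circ> inv_into U c))"
    proof (rule smooth_on_compose[OF _ W(4) op])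
      show "smooth_on (c ` (U \<inter> \<phi> -` W)) (d \<circ> \<phi> \<circ> inv_into U c)"
        using smooth_mapD(1)[OF assms(1) c(1) d(1)] W(3) by (rule_tac smooth_on_subset) auto
      show "open (d ` W)"
        using open_chart_image'[OF d(1) W(1,3)] .
    qed (auto simp: inv_chart[OF c(1)])
    show "((f \<circ> inv_into V d) \<circ> (d \<circ> \<phi> \<circ> inv_into U c)) y = (f \<circ> \<phi> \<circ> inv_into U c) y"
      if "y \<in> c ` (U \<inter> \<phi> -` W)" for y
      using that W(3) by (auto simp: inv_chart[OF c(1)] inv_chart[OF d(1)] subset_iff)
  qed
  then show ?thesis
    unfolding smooth_near_iff_chart[OF c]
    using W c open_chart smooth_mapD(2)[OF assms(1) W(1)] by (intro exI[of _ "U \<inter> \<phi> -` W"]) auto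
qed

text \<open>With \<open>\<phi> = id\<close> this is the change of coordinates for tangent vectors, from which the vector space structure of the tangent space is read off in a
  single chart.\<close>

lemma differential_coord_vector:
  assumes "smooth_map A \<phi>" and c: "(U, c) \<in> A" "x \<in> U" and d: "(V, d) \<in> A" "\<phi> x \<in> V"
  shows "differential A \<phi> x (coord_vector A (U, c) v x) =
    coord_vector A (V, d) (frechet_derivative (d \<circ> \<phi> \<circ> inv_into U c) (at (c x)) v) (\<phi> x)"
proof
  fix f
  show "differential A \<phi> x (coord_vector A (U, c) v x) f =
    coord_vector A (V, d) (frechet_derivative (d \<circ> \<phi> \<circ> inv_into U c) (at (c x)) v) (\<phi> x) f"
  proof (cases "smooth_near A (\<phi> x) f")
    case True
    let ?F = "f \<circ> inv_into V d" and ?P = "d \<circ> \<phi> \<circ> inv_into U c"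
    have eq: "?P (c x) = d (\<phi> x)"
      by (simp add: inv_chart[OF c])
    have dF: "?F differentiable (at (?P (c x)))"
      unfolding eq by (rule smooth_near_differentiable[OF d True])
    have dP: "?P differentiable (at (c x))"
      by (rule smooth_on_differentiable[OF smooth_mapD(1)[OF assms(1) c(1) d(1)]]) (use c d in auto)
    have "frechet_derivative (?F \<circ> ?P) (at (c x)) = frechet_derivative (f \<circ> \<phi> \<circ> inv_into U c) (at (c x))"
    proof (rule frechet_derivative_transform_within_open)
      show "?F \<circ> ?P differentiable (at (c x))"
        using dP dF by (rule differentiable_chain_at)
      show "open (c ` (U \<inter> \<phi> -` V))"
        using c d smooth_mapD(2)[OF assms(1)] open_chart by (intro open_chart_image) auto
      show "(?F \<circ> ?P) y = (f \<circ> \<phi> \<circ> inv_into U c) y" if "y \<in> c ` (U \<inter> \<phi> -` V)" for y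
        using that by (auto simp: inv_chart[OF c(1)] inv_chart[OF d(1)])
    qed (use c d in auto)
    then have "frechet_derivative (f \<circ> \<phi> \<circ> inv_into U c) (at (c x)) v =
        frechet_derivative ?F (at (d (\<phi> x))) (frechet_derivative ?P (at (c x)) v)"
      unfolding frechet_derivative_compose[OF dP dF] eq by (metis o_apply)
    then show ?thesis
      using True smooth_map_near[OF assms(1) True]
      by (simp add: differential_def coord_vector_apply del: o_apply)
  qed (simp add: differential_def coord_vector_apply)
qed

lemma differential_tangent:
  assumes "smooth_map A \<phi>" "X \<in> tangent_space A x"
  shows "differential A \<phi> x X \<in> tangent_space A (\<phi> x)"
proof -
  obtain U c v where "(U, c) \<in> A" "x \<in> U" "X = coord_vector A (U, c) v x"
    using assms(2) by (rule tangent_spaceE)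
  moreover obtain V d where "(V, d) \<in> A" "\<phi> x \<in> V"
    by (rule chart_at)
  ultimately show ?thesis
    using differential_coord_vector[OF assms(1)] coord_vector_tangent by simp
qed

lemma smooth_map_id: "smooth_map A id"
  unfolding smooth_map_def using smooth_transition by auto

lemma smooth_map_compose:
  assumes "smooth_map A \<phi>" "smooth_map A \<psi>"
  shows "smooth_map A (\<psi> \<circ> \<phi>)"
proof -
  have "smooth_on (c ` (U \<inter> (\<psi> \<circ> \<phi>) -` V)) (d \<circ> (\<psi> \<circ> \<phi>) \<circ> inv_into U c)"
    if c: "(U, c) \<in> A" and d: "(V, d) \<in> A" for U c V d
  proof (rule smooth_on_local)
    fix z assume "z \<in> c ` (U \<inter> (\<psi> \<circ> \<phi>) -` V)"
    then obtain x where x: "x \<in> U" "\<psi> (\<phi> x) \<in> V" "z = c x"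
      by auto
    obtain W e where e: "(W, e) \<in> A" "\<phi> x \<in> W"
      by (rule chart_at)
    define W' where "W' = W \<inter> \<psi> -` V"
    have W': "open W'" "W' \<subseteq> W" "\<phi> x \<in> W'" "\<And>y. y \<in> W' \<Longrightarrow> \<psi> y \<in> V"
      using open_chart smooth_mapD(2)[OF assms(2)] d e x by (auto simp: W'_def)
    have op: "open (c ` (U \<inter> \<phi> -` W'))"
      using c smooth_mapD(2)[OF assms(1) W'(1)] by (intro open_chart_image)
    have "smooth_on (c ` (U \<inter> \<phi> -` W')) (d \<circ> (\<psi> \<circ> \<phi>) \<circ> inv_into U c)"
    proof (rule smooth_on_cong[OF _ op])
      show "smooth_on (c ` (U \<inter> \<phi> -` W')) ((d \<circ> \<psi> \<circ> inv_into W e) \<circ> (e \<circ> \<phi> \<circ> inv_into U c))"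
      proof (rule smooth_on_compose[OF _ _ op])
        show "smooth_on (c ` (U \<inter> \<phi> -` W')) (e \<circ> \<phi> \<circ> inv_into U c)"
          using smooth_mapD(1)[OF assms(1) c e(1)] W'(2) by (rule_tac smooth_on_subset) auto
        show "smooth_on (e ` W') (d \<circ> \<psi> \<circ> inv_into W e)"
          unfolding W'_def by (rule smooth_mapD(1)[OF assms(2) e(1) d])
        show "open (e ` W')"
          using open_chart_image'[OF e(1) W'(1,2)] .
      qed (auto simp: inv_chart[OF c])
      show "((d \<circ> \<psi> \<circ> inv_into W e) \<circ> (e \<circ> \<phi> \<circ> inv_into U c)) y =
          (d \<circ> (\<psi> \<circ> \<phi>) \<circ> inv_into U c) y" if "y \<in> c ` (U \<inter> \<phi> -` W')" for y
        using that W'(2) by (auto simp: inv_chart[OF c] inv_chart[OF e(1)] subset_iff)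
    qed
    then show "\<exists>T. open T \<and> z \<in> T \<and> smooth_on T (d \<circ> (\<psi> \<circ> \<phi>) \<circ> inv_into U c)"
      using op x W'(3) by blast
  qed
  moreover have "continuous_on UNIV (\<psi> \<circ> \<phi>)"
    using assms unfolding smooth_map_def by (metis continuous_on_compose continuous_on_subset subset_UNIV)
  ultimately show ?thesis
    unfolding smooth_map_def by blast
qed

lemma differential_id: "X \<in> tangent_space A x \<Longrightarrow> differential A id x X = X"
  using tangent_not_smooth by (fastforce simp: differential_def)

lemma differential_compose:
  assumes "smooth_map A \<psi>"
  shows "differential A \<psi> (\<phi> x) (differential A \<phi> x X) = differential A (\<psi> \<circ> \<phi>) x X"
  using smooth_map_near[OF assms] by (auto simp: differential_def fun_eq_iff comp_assoc)

lemma tangent_space_eq: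
  assumes "(U, c) \<in> A" "x \<in> U"
  shows "tangent_space A x = range (\<lambda>v. coord_vector A (U, c) v x)"
proof
  show "tangent_space A x \<subseteq> range (\<lambda>v. coord_vector A (U, c) v x)"
  proof
    fix X assume X: "X \<in> tangent_space A x"
    then obtain V d v where "(V, d) \<in> A" "x \<in> V" "X = coord_vector A (V, d) v x"
      by (rule tangent_spaceE)
    then have "X = coord_vector A (U, c) (frechet_derivative (c \<circ> id \<circ> inv_into V d) (at (d x)) v) x"
      using differential_coord_vector[OF smooth_map_id, of V d x U c v] assms differential_id[OF X]
      by simp
    then show "X \<in> range (\<lambda>v. coord_vector A (U, c) v x)"
      by blast
  qed
qed (use coord_vector_tangent[OF assms] in auto)

lemma linear_coord_vector:
  assumes "(U, c) \<in> A" "x \<in> U"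
  shows "linear (\<lambda>v. coord_vector A (U, c) v x)"
proof (rule linearI)
  note lin = linear_frechet_derivative[OF smooth_near_differentiable[OF assms]]
  show "coord_vector A (U, c) (v + w) x = coord_vector A (U, c) v x + coord_vector A (U, c) w x" for v w
    using lin by (auto simp: coord_vector_apply fun_eq_iff linear_add)
  show "coord_vector A (U, c) (r *\<^sub>R v) x = r *\<^sub>R coord_vector A (U, c) v x" for r v
    using lin by (auto simp: coord_vector_apply fun_eq_iff linear_scale)
qed

lemma tangent_space_finite_span: "\<exists>B. finite B \<and> tangent_space A x \<subseteq> span B"
proof -
  obtain U c where c: "(U, c) \<in> A" "x \<in> U"
    by (rule chart_at)
  have "tangent_space A x = span ((\<lambda>v. coord_vector A (U, c) v x) ` Basis)"
    unfolding tangent_space_eq[OF c] linear_span_image[OF linear_coord_vector[OF c]] span_Basis ..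
  then show ?thesis
    by (intro exI[of _ "(\<lambda>v. coord_vector A (U, c) v x) ` Basis"]) simp
qed

section \<open>Diffeomorphisms and the push-forward of vector fields\<close>

lemma diffeomorphismD:
  assumes "diffeomorphism A \<phi>"
  shows "bij \<phi>" "smooth_map A \<phi>" "smooth_map A (inv_into UNIV \<phi>)" "inv_into UNIV \<phi> (\<phi> x) = x" "\<phi> (inv_into UNIV \<phi> x) = x"
    "inv_into UNIV \<phi> \<circ> \<phi> = id" "\<phi> \<circ> inv_into UNIV \<phi> = id"
  using assms unfolding diffeomorphism_def
  by (auto simp: fun_eq_iff bij_is_inj bij_is_surj surj_f_inv_f)

lemma diffeomorphism_id: "diffeomorphism A id"
  unfolding diffeomorphism_def by (simp add: smooth_map_id)

lemma diffeomorphism_inv: "diffeomorphism A \<phi> \<Longrightarrow> diffeomorphism A (inv_into UNIV \<phi>)"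
  unfolding diffeomorphism_def by (simp add: bij_imp_bij_inv inv_inv_eq)

lemma diffeomorphism_compose:
  "diffeomorphism A \<phi> \<Longrightarrow> diffeomorphism A \<psi> \<Longrightarrow> diffeomorphism A (\<psi> \<circ> \<phi>)"
  unfolding diffeomorphism_def
  by (simp add: bij_comp smooth_map_compose o_inv_distrib[of \<psi> \<phi>])

lemma smooth_near_diffeo_iff:
  assumes "diffeomorphism A \<phi>"
  shows "smooth_near A x (f \<circ> \<phi>) \<longleftrightarrow> smooth_near A (\<phi> x) f"
proof
  assume "smooth_near A x (f \<circ> \<phi>)"
  then have "smooth_near A (\<phi> x) (f \<circ> \<phi> \<circ> inv_into UNIV \<phi>)"
    using smooth_map_near[OF diffeomorphismD(3)[OF assms], of "\<phi> x"] diffeomorphismD(4)[OF assms]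
    by metis
  then show "smooth_near A (\<phi> x) f"
    by (simp add: comp_assoc diffeomorphismD(7)[OF assms])
qed (rule smooth_map_near[OF diffeomorphismD(2)[OF assms]])

lemma vector_field_tangent: "X \<in> smooth_vector_fields A \<Longrightarrow> X x \<in> tangent_space A x"
  by (simp add: smooth_vector_fields_def)

lemma vector_field_smooth:
  "X \<in> smooth_vector_fields A \<Longrightarrow> smooth_near A x f \<Longrightarrow> smooth_near A x (\<lambda>y. X y f)"
  by (simp add: smooth_vector_fields_def)

text \<open>Because a tangent vector vanishes on the functions that are not smooth near its base point,
  this holds for every function \<open>f\<close>.\<close>

lemma pushforward_apply:
  assumes "diffeomorphism A \<phi>" "X \<in> smooth_vector_fields A"
  shows "pushforward A \<phi> X (\<phi> x) f = X x (f \<circ> \<phi>)"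
  using tangent_not_smooth[OF vector_field_tangent[OF assms(2)], of x "f \<circ> \<phi>"]
  by (simp add: pushforward_def differential_def diffeomorphismD(4)[OF assms(1)]
      smooth_near_diffeo_iff[OF assms(1)])

lemma pushforward_apply_inv:
  assumes "diffeomorphism A \<phi>" "X \<in> smooth_vector_fields A"
  shows "pushforward A \<phi> X y f = X (inv_into UNIV \<phi> y) (f \<circ> \<phi>)"
  using pushforward_apply[OF assms, of "inv_into UNIV \<phi> y"] by (simp add: diffeomorphismD(5)[OF assms(1)])

lemma pushforward_vector_field:
  assumes "diffeomorphism A \<phi>" "X \<in> smooth_vector_fields A"
  shows "pushforward A \<phi> X \<in> smooth_vector_fields A"
proof -
  have "pushforward A \<phi> X y \<in> tangent_space A y" for y
    using differential_tangent[OF diffeomorphismD(2)[OF assms(1)] vector_field_tangent[OF assms(2)], of "inv_into UNIV \<phi> y"]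
    by (simp add: pushforward_def diffeomorphismD(5)[OF assms(1)])
  moreover have "smooth_near A y (\<lambda>z. pushforward A \<phi> X z f)" if "smooth_near A y f" for y f
  proof -
    have "smooth_near A (inv_into UNIV \<phi> y) (f \<circ> \<phi>)"
      using that smooth_near_diffeo_iff[OF assms(1), of "inv_into UNIV \<phi> y" f]
      by (simp add: diffeomorphismD(5)[OF assms(1)])
    then have "smooth_near A (inv_into UNIV \<phi> y) (\<lambda>z. X z (f \<circ> \<phi>))"
      by (rule vector_field_smooth[OF assms(2)])
    then have "smooth_near A y ((\<lambda>z. X z (f \<circ> \<phi>)) \<circ> inv_into UNIV \<phi>)"
      by (rule smooth_map_near[OF diffeomorphismD(3)[OF assms(1)]])
    then show ?thesis
      by (simp add: comp_def pushforward_apply_inv[OF assms])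
  qed
  ultimately show ?thesis
    by (simp add: smooth_vector_fields_def)
qed

lemma linear_pushforward: "linear (pushforward A \<phi>)"
  by (rule linearI) (auto simp: pushforward_def differential_def fun_eq_iff)

lemma pushforward_compose:
  assumes "diffeomorphism A \<phi>" "diffeomorphism A \<psi>" "X \<in> smooth_vector_fields A"
  shows "pushforward A \<psi> (pushforward A \<phi> X) = pushforward A (\<psi> \<circ> \<phi>) X"
proof (intro ext)
  fix y f
  show "pushforward A \<psi> (pushforward A \<phi> X) y f = pushforward A (\<psi> \<circ> \<phi>) X y f"
    using assms
    by (simp add: pushforward_apply_inv pushforward_vector_field diffeomorphism_compose comp_assoc
        o_inv_distrib[OF diffeomorphismD(1) diffeomorphismD(1)])
qed

lemma pushforward_id: "X \<in> smooth_vector_fields A \<Longrightarrow> pushforward A id X = X"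
  by (intro ext) (simp add: pushforward_apply_inv diffeomorphism_id)

lemma pushforward_inv:
  assumes "diffeomorphism A \<phi>" "X \<in> smooth_vector_fields A"
  shows "pushforward A (inv_into UNIV \<phi>) (pushforward A \<phi> X) = X" "pushforward A \<phi> (pushforward A (inv_into UNIV \<phi>) X) = X"
  using assms
  by (simp_all add: pushforward_compose diffeomorphism_inv diffeomorphismD(6,7) pushforward_id)

section \<open>The Lie bracket of vector fields\<close>

lemma lie_bracket_apply:
  "smooth_near A x f \<Longrightarrow> lie_bracket A X Y x f = Y x (\<lambda>y. X y f) - X x (\<lambda>y. Y y f)"
  by (simp add: lie_bracket_def vf_bracket_def)

lemma lie_bracket_not_smooth: "\<not> smooth_near A x f \<Longrightarrow> lie_bracket A X Y x f = 0"
  by (simp add: lie_bracket_def vf_bracket_def)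

lemma vector_field_eqI:
  assumes "\<And>x f. smooth_near A x f \<Longrightarrow> X x f = Y x f"
    and "\<And>x f. \<not> smooth_near A x f \<Longrightarrow> X x f = Y x f"
  shows "X = Y"
  using assms by blast

lemma lie_bracket_swap: "lie_bracket A X Y = - lie_bracket A Y X"
  by (auto simp: lie_bracket_def vf_bracket_def fun_eq_iff)

lemma lie_bracket_add_right:
  assumes "X \<in> smooth_vector_fields A" "Y \<in> smooth_vector_fields A" "Z \<in> smooth_vector_fields A"
  shows "lie_bracket A X (Y + Z) = lie_bracket A X Y + lie_bracket A X Z"
proof (rule vector_field_eqI)
  show "lie_bracket A X (Y + Z) x f = (lie_bracket A X Y + lie_bracket A X Z) x f"
    if "smooth_near A x f" for x f
    using tangent_add[OF vector_field_tangent[OF assms(1)] vector_field_smooth[OF assms(2) that]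
      vector_field_smooth[OF assms(3) that]] that
    by (simp add: lie_bracket_apply)
qed (simp add: lie_bracket_not_smooth)

lemma lie_bracket_scale_right:
  assumes "X \<in> smooth_vector_fields A" "Y \<in> smooth_vector_fields A"
  shows "lie_bracket A X (r *\<^sub>R Y) = r *\<^sub>R lie_bracket A X Y"
proof (rule vector_field_eqI)
  show "lie_bracket A X (r *\<^sub>R Y) x f = (r *\<^sub>R lie_bracket A X Y) x f"
    if "smooth_near A x f" for x f
    using tangent_scale[OF vector_field_tangent[OF assms(1)] vector_field_smooth[OF assms(2) that]] that
    by (simp add: lie_bracket_apply right_diff_distrib)
qed (simp add: lie_bracket_not_smooth)

text \<open>The bracket \<open>[Y, Z] f\<close> is a difference of smooth functions only where \<open>f\<close> is smooth, so expanding
  an iterated bracket uses that \<open>X x\<close> depends on germs at \<open>x\<close> only.\<close>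

lemma lie_bracket_lie_bracket:
  assumes X: "X \<in> smooth_vector_fields A" and Y: "Y \<in> smooth_vector_fields A"
    and Z: "Z \<in> smooth_vector_fields A" and f: "smooth_near A x f"
  shows "lie_bracket A X (lie_bracket A Y Z) x f =
    Z x (\<lambda>y. Y y (\<lambda>z. X z f)) - Y x (\<lambda>y. Z y (\<lambda>z. X z f))
    - (X x (\<lambda>y. Z y (\<lambda>z. Y z f)) - X x (\<lambda>y. Y y (\<lambda>z. Z z f)))"
proof -
  obtain W where W: "open W" "x \<in> W" "\<And>y. y \<in> W \<Longrightarrow> smooth_near A y f"
    using smooth_near_nhd[OF f] by blast
  have "X x (\<lambda>y. lie_bracket A Y Z y f) = X x (\<lambda>y. Z y (\<lambda>z. Y z f) - Y y (\<lambda>z. Z z f))"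
    using W by (intro tangent_local[OF vector_field_tangent[OF X]] lie_bracket_apply) auto
  also have "\<dots> = X x (\<lambda>y. Z y (\<lambda>z. Y z f)) - X x (\<lambda>y. Y y (\<lambda>z. Z z f))"
    using vector_field_smooth[OF Y] vector_field_smooth[OF Z] f
    by (intro tangent_diff[OF vector_field_tangent[OF X]]) auto
  finally show ?thesis
    using vector_field_smooth[OF X f] f by (simp add: lie_bracket_apply)
qed

lemma lie_bracket_jacobi:
  assumes "X \<in> smooth_vector_fields A" "Y \<in> smooth_vector_fields A" "Z \<in> smooth_vector_fields A"
  shows "lie_bracket A X (lie_bracket A Y Z) + lie_bracket A Y (lie_bracket A Z X)
    + lie_bracket A Z (lie_bracket A X Y) = 0"
  by (rule vector_field_eqI) (simp_all add: lie_bracket_lie_bracket lie_bracket_not_smooth assms)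

lemma pushforward_lie_bracket:
  assumes "diffeomorphism A \<phi>" "X \<in> smooth_vector_fields A" "Y \<in> smooth_vector_fields A"
  shows "pushforward A \<phi> (lie_bracket A X Y) = lie_bracket A (pushforward A \<phi> X) (pushforward A \<phi> Y)"
proof (rule vector_field_eqI)
  have comp: "(\<lambda>z. pushforward A \<phi> V z f) \<circ> \<phi> = (\<lambda>y. V y (f \<circ> \<phi>))"
    if "V \<in> smooth_vector_fields A" for V f
    by (simp add: fun_eq_iff pushforward_apply[OF assms(1) that])
  fix y f
  assume f: "smooth_near A y f"
  then have f': "smooth_near A (inv_into UNIV \<phi> y) (f \<circ> \<phi>)"
    using smooth_near_diffeo_iff[OF assms(1), of "inv_into UNIV \<phi> y" f] by (simp add: diffeomorphismD(5)[OF assms(1)])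
  have "pushforward A \<phi> (lie_bracket A X Y) y f = lie_bracket A X Y (inv_into UNIV \<phi> y) (f \<circ> \<phi>)"
    using f by (simp add: pushforward_def differential_def diffeomorphismD(5)[OF assms(1)])
  also have "\<dots> = lie_bracket A (pushforward A \<phi> X) (pushforward A \<phi> Y) y f"
    using f f' assms(2,3)
    by (simp add: lie_bracket_apply comp pushforward_apply_inv[OF assms(1,2), of y]
        pushforward_apply_inv[OF assms(1,3), of y])
  finally show "pushforward A \<phi> (lie_bracket A X Y) y f =
    lie_bracket A (pushforward A \<phi> X) (pushforward A \<phi> Y) y f" .
next
  fix y f
  assume "\<not> smooth_near A y f"
  then show "pushforward A \<phi> (lie_bracket A X Y) y f =
    lie_bracket A (pushforward A \<phi> X) (pushforward A \<phi> Y) y f"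
    by (simp add: lie_bracket_not_smooth pushforward_def differential_def diffeomorphismD(5)[OF assms(1)])
qed

section \<open>Isometries\<close>

lemma isometry_diffeomorphism: "\<phi> \<in> isometries A g \<Longrightarrow> diffeomorphism A \<phi>"
  by (simp add: isometries_def)

lemma isometry_id: "id \<in> isometries A g"
  by (simp add: isometries_def diffeomorphism_id differential_id)

lemma isometry_compose:
  assumes "\<phi> \<in> isometries A g" "\<psi> \<in> isometries A g"
  shows "\<psi> \<circ> \<phi> \<in> isometries A g"
proof -
  note \<phi> = isometry_diffeomorphism[OF assms(1)] and \<psi> = isometry_diffeomorphism[OF assms(2)]
  have "g (\<psi> (\<phi> x)) (differential A (\<psi> \<circ> \<phi>) x u) (differential A (\<psi> \<circ> \<phi>) x v) = g x u v"
    if "u \<in> tangent_space A x" "v \<in> tangent_space A x" for x u v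
    unfolding differential_compose[OF diffeomorphismD(2)[OF \<psi>], symmetric]
    using assms that differential_tangent[OF diffeomorphismD(2)[OF \<phi>]] by (simp add: isometries_def)
  then show ?thesis
    using diffeomorphism_compose[OF \<phi> \<psi>] by (simp add: isometries_def)
qed

lemma isometry_inv:
  assumes "\<phi> \<in> isometries A g"
  shows "inv_into UNIV \<phi> \<in> isometries A g"
proof -
  note \<phi> = isometry_diffeomorphism[OF assms]
  let ?\<psi> = "inv_into UNIV \<phi>"
  have "g (?\<psi> x) (differential A ?\<psi> x u) (differential A ?\<psi> x v) = g x u v"
    if uv: "u \<in> tangent_space A x" "v \<in> tangent_space A x" for x u v
  proof -
    have "g (\<phi> (?\<psi> x)) (differential A \<phi> (?\<psi> x) (differential A ?\<psi> x u))
        (differential A \<phi> (?\<psi> x) (differential A ?\<psi> x v)) =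
      g (?\<psi> x) (differential A ?\<psi> x u) (differential A ?\<psi> x v)"
      using assms uv differential_tangent[OF diffeomorphismD(3)[OF \<phi>]] by (simp add: isometries_def)
    then show ?thesis
      unfolding differential_compose[OF diffeomorphismD(2)[OF \<phi>]]
      by (simp add: diffeomorphismD(5,7)[OF \<phi>] differential_id uv)
  qed
  then show ?thesis
    using diffeomorphism_inv[OF \<phi>] by (simp add: isometries_def)
qed

lemma identity_component_subset: "isometry_identity_component A g \<subseteq> isometries A g"
  unfolding isometry_identity_component_def
  using connected_component_of_subset_topspace[of "subtopology compact_open_topology (isometries A g)" id]
  by auto

section \<open>Conjugation by a diffeomorphism\<close>

definition conjugation :: "('m \<Rightarrow> 'm) \<Rightarrow> ('m \<Rightarrow> 'm) \<Rightarrow> 'm \<Rightarrow> 'm"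
  where "conjugation \<phi> f = \<phi> \<circ> f \<circ> inv_into UNIV \<phi>"

lemma conjugation_compose:
  "diffeomorphism A \<phi> \<Longrightarrow> conjugation \<phi> (f \<circ> h) = conjugation \<phi> f \<circ> conjugation \<phi> h"
  by (simp add: conjugation_def fun_eq_iff diffeomorphismD(4))

lemma conjugation_id: "diffeomorphism A \<phi> \<Longrightarrow> conjugation \<phi> id = id"
  by (simp add: conjugation_def diffeomorphismD(7))

lemma conjugation_inv:
  assumes "diffeomorphism A \<phi>"
  shows "conjugation (inv_into UNIV \<phi>) (conjugation \<phi> f) = f"
    "conjugation \<phi> (conjugation (inv_into UNIV \<phi>) f) = f"
  by (simp_all add: conjugation_def fun_eq_iff diffeomorphismD(4,5)[OF assms]
      inv_inv_eq[OF diffeomorphismD(1)[OF assms]])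

lemma conjugation_inv_image:
  "diffeomorphism A \<phi> \<Longrightarrow> conjugation (inv_into UNIV \<phi>) ` conjugation \<phi> ` K = K"
  by (simp add: image_image conjugation_inv)

lemma topspace_compact_open: "topspace (compact_open_topology :: ('a::topological_space \<Rightarrow> 'b::topological_space) topology) = UNIV"
proof -
  have "{f :: 'a \<Rightarrow> 'b. f ` {} \<subseteq> UNIV} \<in> {{f. f ` K \<subseteq> U} | K U. compact K \<and> open U}"
    by blast
  then show ?thesis
    unfolding compact_open_topology_def topology_generated_by_topspace by blast
qed

lemma openin_compact_open:
  "compact K \<Longrightarrow> open U \<Longrightarrow> openin compact_open_topology {f. f ` K \<subseteq> U}"
  unfolding compact_open_topology_def by (rule topology_generated_by_Basis) blast

lemma continuous_map_conjugation:
  assumes "diffeomorphism A \<phi>"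
  shows "continuous_map compact_open_topology compact_open_topology (conjugation \<phi>)"
  unfolding compact_open_topology_def[where ?'a = 'm and ?'b = 'm] continuous_on_generated_topo_iff
  unfolding compact_open_topology_def[symmetric] topspace_compact_open
proof (intro conjI allI impI)
  let ?\<psi> = "inv_into UNIV \<phi>"
  fix S assume "S \<in> {{f :: 'm \<Rightarrow> 'm. f ` K \<subseteq> U} | K U. compact K \<and> open U}"
  then obtain K U where KU: "compact K" "open U" "S = {f. f ` K \<subseteq> U}"
    by blast
  have "conjugation \<phi> -` S = {f. f ` (?\<psi> ` K) \<subseteq> \<phi> -` U}"
    by (auto simp: KU(3) conjugation_def)
  moreover have "compact (?\<psi> ` K)"
    using diffeomorphismD(3)[OF assms] KU(1) unfolding smooth_map_def
    by (blast intro: compact_continuous_image continuous_on_subset)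
  ultimately show "openin compact_open_topology (conjugation \<phi> -` S \<inter> UNIV)"
    using openin_compact_open smooth_mapD(2)[OF diffeomorphismD(2)[OF assms] KU(2)] by auto
next
  show "conjugation \<phi> ` UNIV \<subseteq> \<Union> {{f :: 'm \<Rightarrow> 'm. f ` K \<subseteq> U} | K U. compact K \<and> open U}"
    using topspace_compact_open[where ?'a = 'm and ?'b = 'm]
    unfolding compact_open_topology_def topology_generated_by_topspace by blast
qed

text \<open>Conjugation is a self-homeomorphism of the isometry group that fixes the identity, hence it
  preserves the component of the identity. The isometry \<open>\<phi>\<close> itself may lie in another component, as
  may the reversing isometries of a weakly symmetric space.\<close>

lemma conjugation_identity_component:
  assumes "\<phi> \<in> isometries A g"
  shows "conjugation \<phi> ` isometry_identity_component A g = isometry_identity_component A g"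
proof -
  let ?X = "subtopology compact_open_topology (isometries A g)"
  let ?\<psi> = "inv_into UNIV \<phi>"
  note \<phi> = isometry_diffeomorphism[OF assms]
  have cont: "continuous_map ?X ?X (conjugation \<theta>)" if \<theta>: "\<theta> \<in> isometries A g" for \<theta>
    unfolding continuous_map_in_subtopology
    using continuous_map_from_subtopology[OF continuous_map_conjugation[OF isometry_diffeomorphism[OF \<theta>]]]
      isometry_compose isometry_inv \<theta> by (auto simp: conjugation_def)
  have "homeomorphic_maps ?X ?X (conjugation \<phi>) (conjugation ?\<psi>)"
    unfolding homeomorphic_maps_def using cont[OF assms] cont[OF isometry_inv[OF assms]] conjugation_inv[OF \<phi>]
    by simp
  then have "homeomorphic_map ?X ?X (conjugation \<phi>)"
    by (rule homeomorphic_maps_imp_map)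
  moreover have "id \<in> topspace ?X"
    by (simp add: topspace_compact_open isometry_id)
  ultimately show ?thesis
    unfolding isometry_identity_component_def
    using homeomorphic_map_connected_component_of[of ?X ?X "conjugation \<phi>" id] conjugation_id[OF \<phi>]
    by simp
qed

lemma one_parameter_subgroup_conjugation:
  assumes "diffeomorphism A \<phi>" "one_parameter_subgroup K \<gamma>"
  shows "one_parameter_subgroup (conjugation \<phi> ` K) (\<lambda>t. conjugation \<phi> (\<gamma> t))"
proof -
  have \<gamma>: "continuous_map euclideanreal compact_open_topology \<gamma>" "\<And>t. \<gamma> t \<in> K"
    using assms(2) by (auto simp: one_parameter_subgroup_def continuous_map_in_subtopology)
  have "continuous_map euclideanreal compact_open_topology (conjugation \<phi> \<circ> \<gamma>)"
    using \<gamma>(1) continuous_map_conjugation[OF assms(1)] by (rule continuous_map_compose)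
  then show ?thesis
    using assms \<gamma>(2)
    by (auto simp: one_parameter_subgroup_def continuous_map_in_subtopology comp_def[of "conjugation \<phi>"]
        conjugation_compose conjugation_id)
qed

lemma one_parameter_subgroup_in: "one_parameter_subgroup K \<gamma> \<Longrightarrow> \<gamma> t \<in> K"
  by (auto simp: one_parameter_subgroup_def continuous_map_in_subtopology)

lemma one_parameter_subgroup_conjugation_image:
  assumes "diffeomorphism A \<phi>"
  shows "{\<gamma> t | \<gamma> t. one_parameter_subgroup (conjugation \<phi> ` K) \<gamma>} =
    conjugation \<phi> ` {\<gamma> t | \<gamma> t. one_parameter_subgroup K \<gamma>}"
proof
  let ?\<psi> = "inv_into UNIV \<phi>"
  show "{\<gamma> t | \<gamma> t. one_parameter_subgroup (conjugation \<phi> ` K) \<gamma>} \<subseteq>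
    conjugation \<phi> ` {\<gamma> t | \<gamma> t. one_parameter_subgroup K \<gamma>}"
  proof clarify
    fix \<gamma> t assume "one_parameter_subgroup (conjugation \<phi> ` K) \<gamma>"
    then have "one_parameter_subgroup K (\<lambda>t. conjugation ?\<psi> (\<gamma> t))"
      using one_parameter_subgroup_conjugation[OF diffeomorphism_inv[OF assms]]
        conjugation_inv_image[OF assms, of K] by metis
    then show "\<gamma> t \<in> conjugation \<phi> ` {\<gamma> t | \<gamma> t. one_parameter_subgroup K \<gamma>}"
      using conjugation_inv(2)[OF assms, of "\<gamma> t"] by (intro image_eqI[of _ _ "conjugation ?\<psi> (\<gamma> t)"]) auto
  qed
  show "conjugation \<phi> ` {\<gamma> t | \<gamma> t. one_parameter_subgroup K \<gamma>} \<subseteq>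
    {\<gamma> t | \<gamma> t. one_parameter_subgroup (conjugation \<phi> ` K) \<gamma>}"
  proof clarify
    fix \<gamma> t assume "one_parameter_subgroup K \<gamma>"
    then show "\<exists>\<gamma>' t'. conjugation \<phi> (\<gamma> t) = \<gamma>' t' \<and> one_parameter_subgroup (conjugation \<phi> ` K) \<gamma>'"
      by (intro exI[of _ "\<lambda>t. conjugation \<phi> (\<gamma> t)"] exI[of _ t] conjI refl
          one_parameter_subgroup_conjugation[OF assms])
  qed
qed

lemma lie_algebra_vector_field: "X \<in> lie_algebra A K \<Longrightarrow> X \<in> smooth_vector_fields A"
  by (simp add: lie_algebra_def)

lemma lie_algebra_mono:
  assumes "K \<subseteq> K'"
  shows "lie_algebra A K \<subseteq> lie_algebra A K'"
proof -
  have "one_parameter_subgroup K' \<gamma>" if "one_parameter_subgroup K \<gamma>" for \<gamma>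
    using that assms by (auto simp: one_parameter_subgroup_def continuous_map_in_subtopology)
  then show ?thesis
    unfolding lie_algebra_def by blast
qed

lemma pushforward_lie_algebra:
  assumes "diffeomorphism A \<phi>" "X \<in> lie_algebra A K"
  shows "pushforward A \<phi> X \<in> lie_algebra A (conjugation \<phi> ` K)"
proof -
  obtain \<gamma> where \<gamma>: "one_parameter_subgroup K \<gamma>" "infinitesimal_generator A \<gamma> X"
    using assms(2) by (auto simp: lie_algebra_def)
  note X = lie_algebra_vector_field[OF assms(2)]
  have "infinitesimal_generator A (\<lambda>t. conjugation \<phi> (\<gamma> t)) (pushforward A \<phi> X)"
    unfolding infinitesimal_generator_def
  proof (intro allI impI)
    fix y f assume "smooth_near A y f"
    then have "smooth_near A (inv_into UNIV \<phi> y) (f \<circ> \<phi>)"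
      using smooth_near_diffeo_iff[OF assms(1), of "inv_into UNIV \<phi> y" f]
      by (simp add: diffeomorphismD(5)[OF assms(1)])
    then have "((\<lambda>t. (f \<circ> \<phi>) (\<gamma> t (inv_into UNIV \<phi> y))) has_real_derivative
        X (inv_into UNIV \<phi> y) (f \<circ> \<phi>)) (at 0)"
      using \<gamma>(2) unfolding infinitesimal_generator_def by blast
    then show "((\<lambda>t. f (conjugation \<phi> (\<gamma> t) y)) has_real_derivative pushforward A \<phi> X y f) (at 0)"
      by (simp add: conjugation_def pushforward_apply_inv[OF assms(1) X])
  qed
  then show ?thesis
    using one_parameter_subgroup_conjugation[OF assms(1) \<gamma>(1)] pushforward_vector_field[OF assms(1) X]
    unfolding lie_algebra_def by blast
qed

text \<open>This identifies \<open>Ad \<phi>\<close> with the push-forward, so that the Lie algebra conditions in the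
  definition of the nilradical are transported along conjugation.\<close>

lemma lie_algebra_conjugation:
  assumes "diffeomorphism A \<phi>"
  shows "lie_algebra A (conjugation \<phi> ` K) = pushforward A \<phi> ` lie_algebra A K"
proof
  show "lie_algebra A (conjugation \<phi> ` K) \<subseteq> pushforward A \<phi> ` lie_algebra A K"
  proof
    fix X assume X: "X \<in> lie_algebra A (conjugation \<phi> ` K)"
    then have "pushforward A (inv_into UNIV \<phi>) X \<in> lie_algebra A K"
      using pushforward_lie_algebra[OF diffeomorphism_inv[OF assms] X] conjugation_inv_image[OF assms, of K]
      by simp
    then show "X \<in> pushforward A \<phi> ` lie_algebra A K"
      using pushforward_inv(2)[OF assms lie_algebra_vector_field[OF X]] by (metis image_eqI)
  qed
qed (use pushforward_lie_algebra[OF assms] in blast)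

lemma bracket_space_pushforward:
  assumes "diffeomorphism A \<phi>" "P \<subseteq> smooth_vector_fields A" "Q \<subseteq> smooth_vector_fields A"
  shows "bracket_space A (pushforward A \<phi> ` P) (pushforward A \<phi> ` Q) = pushforward A \<phi> ` bracket_space A P Q"
proof -
  have "{lie_bracket A X Y | X Y. X \<in> pushforward A \<phi> ` P \<and> Y \<in> pushforward A \<phi> ` Q} =
    pushforward A \<phi> ` {lie_bracket A X Y | X Y. X \<in> P \<and> Y \<in> Q}" (is "?l = ?r")
  proof
    show "?l \<subseteq> ?r"
    proof clarify
      fix X Y assume XY: "X \<in> P" "Y \<in> Q"
      then have "lie_bracket A (pushforward A \<phi> X) (pushforward A \<phi> Y) = pushforward A \<phi> (lie_bracket A X Y)"
        using pushforward_lie_bracket[OF assms(1)] assms(2,3) by (metis subsetD)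
      then show "lie_bracket A (pushforward A \<phi> X) (pushforward A \<phi> Y) \<in> ?r"
        using XY by blast
    qed
    show "?r \<subseteq> ?l"
    proof clarify
      fix X Y assume XY: "X \<in> P" "Y \<in> Q"
      then have "pushforward A \<phi> (lie_bracket A X Y) = lie_bracket A (pushforward A \<phi> X) (pushforward A \<phi> Y)"
        using pushforward_lie_bracket[OF assms(1)] assms(2,3) by (metis subsetD)
      then show "\<exists>U V. pushforward A \<phi> (lie_bracket A X Y) = lie_bracket A U V \<and>
          U \<in> pushforward A \<phi> ` P \<and> V \<in> pushforward A \<phi> ` Q"
        using XY by blast
    qed
  qed
  then show ?thesis
    unfolding bracket_space_def by (simp add: linear_span_image[OF linear_pushforward])
qed

lemma lower_central_series_subset:
  assumes "lie_subalgebra A L"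
  shows "lower_central_series A L k \<subseteq> L"
proof (induction k)
  case (Suc k)
  then show ?case
    unfolding lower_central_series.simps bracket_space_def using assms
    by (intro span_minimal) (auto simp: lie_subalgebra_def)
qed simp

lemma lower_central_series_pushforward:
  assumes "diffeomorphism A \<phi>" "lie_subalgebra A L" "L \<subseteq> smooth_vector_fields A"
  shows "lower_central_series A (pushforward A \<phi> ` L) k = pushforward A \<phi> ` lower_central_series A L k"
proof (induction k)
  case (Suc k)
  have "lower_central_series A L k \<subseteq> smooth_vector_fields A"
    using lower_central_series_subset[OF assms(2)] assms(3) by blast
  then show ?case
    using Suc bracket_space_pushforward[OF assms(1,3)] by simp
qed simp

lemma lie_subalgebra_pushforward:
  assumes "diffeomorphism A \<phi>" "lie_subalgebra A L" "L \<subseteq> smooth_vector_fields A"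
  shows "lie_subalgebra A (pushforward A \<phi> ` L)"
  unfolding lie_subalgebra_def
proof (intro conjI ballI)
  show "subspace (pushforward A \<phi> ` L)"
    using assms(2) linear_subspace_image[OF linear_pushforward] by (auto simp: lie_subalgebra_def)
  fix U V assume "U \<in> pushforward A \<phi> ` L" "V \<in> pushforward A \<phi> ` L"
  then obtain X Y where XY: "X \<in> L" "Y \<in> L" "U = pushforward A \<phi> X" "V = pushforward A \<phi> Y"
    by blast
  then have "lie_bracket A U V = pushforward A \<phi> (lie_bracket A X Y)"
    using pushforward_lie_bracket[OF assms(1), of X Y] assms(3) by (simp add: subset_iff)
  then show "lie_bracket A U V \<in> pushforward A \<phi> ` L"
    using assms(2) XY(1,2) by (auto simp: lie_subalgebra_def)
qed

lemma connected_nilpotent_normal_conjugation: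
  assumes \<phi>: "diffeomorphism A \<phi>" and G: "conjugation \<phi> ` G = G"
    and K: "connected_nilpotent_normal A G K"
  shows "connected_nilpotent_normal A G (conjugation \<phi> ` K)"
proof -
  let ?G = "composition_group G" and ?C = "conjugation \<phi>"
  have sub: "subgroup K ?G" and L: "lie_subalgebra A (lie_algebra A K)"
    and gen: "K = generate ?G {\<gamma> t | \<gamma> t. one_parameter_subgroup K \<gamma>}"
    and nor: "normal K ?G" and nil: "nilpotent_lie_algebra A (lie_algebra A K)"
    using K by (auto simp: connected_nilpotent_normal_def connected_lie_subgroup_def)
  have vf: "lie_algebra A K \<subseteq> smooth_vector_fields A"
    using lie_algebra_vector_field by blast
  have grp: "group ?G"
    using nor by (simp add: normal_def)
  have "?C \<in> hom ?G ?G"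
    using G by (auto simp: hom_def composition_group_def conjugation_compose[OF \<phi>])
  then interpret C: group_hom ?G ?G ?C
    using grp by (simp add: group_hom_def group_hom_axioms_def)
  have "K \<subseteq> carrier ?G"
    using sub by (rule subgroup.subset)
  then have "{\<gamma> t | \<gamma> t. one_parameter_subgroup K \<gamma>} \<subseteq> carrier ?G"
    using one_parameter_subgroup_in by blast
  from C.generate_img[OF this]
  have "?C ` K = generate ?G {\<gamma> t | \<gamma> t. one_parameter_subgroup (?C ` K) \<gamma>}"
    unfolding one_parameter_subgroup_conjugation_image[OF \<phi>] using gen by simp
  moreover have "normal (?C ` K) ?G"
    using normal.surj_hom_normal_subgroup[OF nor C.group_hom_axioms] G
    by (simp add: composition_group_def)
  moreover have "subgroup (?C ` K) ?G"
    using C.subgroup_img_is_subgroup[OF sub] .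
  moreover have "lie_subalgebra A (lie_algebra A (?C ` K))"
    unfolding lie_algebra_conjugation[OF \<phi>] by (rule lie_subalgebra_pushforward[OF \<phi> L vf])
  moreover have "nilpotent_lie_algebra A (lie_algebra A (?C ` K))"
  proof -
    obtain k where "lower_central_series A (lie_algebra A K) k = {0}"
      using nil by (auto simp: nilpotent_lie_algebra_def)
    then have "lower_central_series A (pushforward A \<phi> ` lie_algebra A K) k = {0}"
      by (simp add: lower_central_series_pushforward[OF \<phi> L vf] linear_0[OF linear_pushforward])
    then show ?thesis
      unfolding lie_algebra_conjugation[OF \<phi>] nilpotent_lie_algebra_def by blast
  qed
  ultimately show ?thesis
    unfolding connected_nilpotent_normal_def connected_lie_subgroup_def by blast
qed

text \<open>The nilradical is characteristic: a conjugate of it by an isometry is again a connected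
  nilpotent normal subgroup, so it is contained in the largest one.\<close>

lemma pushforward_nilradical:
  assumes "\<phi> \<in> isometries A g" "is_nilradical A (isometry_identity_component A g) N"
    and "X \<in> lie_algebra A N"
  shows "pushforward A \<phi> X \<in> lie_algebra A N"
proof -
  note \<phi> = isometry_diffeomorphism[OF assms(1)]
  have "conjugation \<phi> ` N \<subseteq> N"
    using assms(2) connected_nilpotent_normal_conjugation[OF \<phi> conjugation_identity_component[OF assms(1)]]
    by (simp add: is_nilradical_def)
  then show ?thesis
    using pushforward_lie_algebra[OF \<phi> assms(3)] lie_algebra_mono by blast
qed

section \<open>Vector fields that vanish at a point\<close>

text \<open>By the group law, the curve \<open>t \<mapsto> \<gamma> t p\<close> has at time \<open>s\<close> the velocity \<open>d(\<gamma> s)(X p) = 0\<close>. It is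
  therefore constant as long as it stays in one chart, and so, by continuity, for all times.\<close>

lemma flow_fixes_zero:
  assumes diffeo: "\<And>\<phi>. \<phi> \<in> G \<Longrightarrow> diffeomorphism A \<phi>"
    and \<gamma>: "one_parameter_subgroup G \<gamma>" "infinitesimal_generator A \<gamma> X"
    and zero: "X p = 0"
  shows "\<gamma> t p = p"
proof -
  have add: "\<gamma> (s + t) = \<gamma> s \<circ> \<gamma> t" and id: "\<gamma> 0 = id" for s t
    using \<gamma>(1) by (auto simp: one_parameter_subgroup_def)
  have cont: "open {t. \<gamma> t p \<in> U}" if "open U" for U
  proof -
    have "openin euclideanreal {t \<in> topspace euclideanreal. \<gamma> t \<in> {f. f ` {p} \<subseteq> U}}"
      using \<gamma>(1) that openin_compact_open[of "{p}" U]
      by (intro openin_continuous_map_preimage[of _ compact_open_topology])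
        (auto simp: one_parameter_subgroup_def continuous_map_in_subtopology)
    then show ?thesis
      by simp
  qed
  have deriv: "((\<lambda>t. f (\<gamma> t p)) has_real_derivative 0) (at s)" if "smooth_near A (\<gamma> s p) f" for f s
  proof -
    have "smooth_near A p (f \<circ> \<gamma> s)"
      using that smooth_map_near[OF diffeomorphismD(2)[OF diffeo[OF one_parameter_subgroup_in[OF \<gamma>(1)]]]]
      by blast
    then have "((\<lambda>t. (f \<circ> \<gamma> s) (\<gamma> t p)) has_real_derivative 0) (at 0)"
      using \<gamma>(2) zero unfolding infinitesimal_generator_def by (metis zero_fun_apply)
    then have "((\<lambda>t. f (\<gamma> (s + t) p)) has_real_derivative 0) (at 0)"
      by (simp add: add)
    then show ?thesis
      using DERIV_shift[of "\<lambda>t. f (\<gamma> t p)" 0 0 s] by (simp add: add.commute)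
  qed
  have "\<forall>s\<in>UNIV. \<forall>\<^sub>F t in at s. \<gamma> s p = \<gamma> t p"
  proof
    fix s :: real
    obtain U c where c: "(U, c) \<in> A" "\<gamma> s p \<in> U"
      by (rule chart_at)
    obtain e where e: "e > 0" "ball s e \<subseteq> {t. \<gamma> t p \<in> U}"
      using cont[OF open_chart[OF c(1)]] c(2) unfolding open_contains_ball by blast
    have "\<gamma> s p = \<gamma> t p" if t: "t \<in> ball s e" for t
    proof -
      have "c (\<gamma> s p) \<bullet> b = c (\<gamma> t p) \<bullet> b" for b
      proof (rule has_derivative_zero_unique[of "ball s e" "\<lambda>t. c (\<gamma> t p) \<bullet> b" s t])
        fix r assume r: "r \<in> ball s e"
        have "smooth_near A (\<gamma> r p) (\<lambda>y. c y \<bullet> b)"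
          using r e(2) by (intro smooth_near_coordinate[OF c(1) _ bounded_linear_inner_left]) auto
        then have "((\<lambda>t. c (\<gamma> t p) \<bullet> b) has_real_derivative 0) (at r)"
          by (rule deriv)
        then show "((\<lambda>t. c (\<gamma> t p) \<bullet> b) has_derivative (\<lambda>h. 0)) (at r within ball s e)"
          by (simp add: has_field_derivative_def has_derivative_at_withinI lambda_zero)
      qed (use e t in auto)
      then have "c (\<gamma> s p) = c (\<gamma> t p)"
        by (auto intro: euclidean_eqI)
      then show ?thesis
        using inv_chart[OF c(1), of "\<gamma> s p"] inv_chart[OF c(1), of "\<gamma> t p"] c(2) t e(2) by auto
    qed
    then show "\<forall>\<^sub>F t in at s. \<gamma> s p = \<gamma> t p"
      using e(1) unfolding eventually_at by (auto simp: dist_commute intro!: exI[of _ e])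
  qed
  then have "\<gamma> t p = \<gamma> 0 p"
    using connected_local_const[of UNIV t 0 "\<lambda>t. \<gamma> t p"] connected_UNIV by simp
  then show ?thesis
    by (simp add: id)
qed

lemma isotropy_lie_algebra_of_zero:
  assumes "\<And>\<phi>. \<phi> \<in> G \<Longrightarrow> diffeomorphism A \<phi>" "X \<in> lie_algebra A G" "X p = 0"
  shows "X \<in> lie_algebra A (isotropy_subgroup G p)"
proof -
  obtain \<gamma> where \<gamma>: "one_parameter_subgroup G \<gamma>" "infinitesimal_generator A \<gamma> X"
    using assms(2) by (auto simp: lie_algebra_def)
  have "\<gamma> t p = p" for t
    by (rule flow_fixes_zero[OF assms(1) \<gamma> assms(3)])
  then have "one_parameter_subgroup (isotropy_subgroup G p) \<gamma>"
    using \<gamma>(1) by (auto simp: one_parameter_subgroup_def continuous_map_in_subtopology isotropy_subgroup_def)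
  then show ?thesis
    using assms(2) \<gamma>(2) by (auto simp: lie_algebra_def)
qed

end

section \<open>Nilpotent Lie algebras with many reversing automorphisms\<close>

text \<open>Gram--Schmidt, one spanning vector at a time. Only the restriction of \<open>q\<close> to the subspace onto
  which one projects is definite, while \<open>y\<close> ranges over the larger space \<open>V\<close>.\<close>

lemma orthogonal_projection_finite_span:
  fixes q :: "'v::real_vector \<Rightarrow> 'v \<Rightarrow> real"
  assumes V: "subspace V"
    and add: "\<And>x y z. x \<in> V \<Longrightarrow> y \<in> V \<Longrightarrow> z \<in> V \<Longrightarrow> q (x + y) z = q x z + q y z"
    and scale: "\<And>r x z. x \<in> V \<Longrightarrow> z \<in> V \<Longrightarrow> q (r *\<^sub>R x) z = r * q x z"
    and sym: "\<And>x y. x \<in> V \<Longrightarrow> y \<in> V \<Longrightarrow> q x y = q y x"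
    and "finite B" "B \<subseteq> V" "\<And>x. x \<in> span B \<Longrightarrow> x \<noteq> 0 \<Longrightarrow> q x x > 0" "y \<in> V"
  shows "\<exists>x\<in>span B. \<forall>z\<in>span B. q (y - x) z = 0"
  using assms(5-8)
proof (induction B arbitrary: y rule: finite_induct)
  case empty
  have "q y 0 = 0"
    using scale[of 0 y 0] sym[of y 0] V empty.prems by (simp add: subspace_0)
  then show ?case
    by simp
next
  case (insert b B)
  have diff: "q (x - y) z = q x z - q y z" if "x \<in> V" "y \<in> V" "z \<in> V" for x y z
    using add[of x "- y" z] scale[of y z "- 1"] that V by (simp add: subspace_neg)
  have sB: "span B \<subseteq> V"
    using insert.prems(1) V by (simp add: span_minimal)
  have pos: "q x x > 0" if "x \<in> span B" "x \<noteq> 0" for x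
    using insert.prems(2) that span_mono[of B "insert b B"] by blast
  note IH = insert.IH[OF _ pos]
  obtain b0 where b0: "b0 \<in> span B" "\<forall>z\<in>span B. q (b - b0) z = 0"
    using IH[of b] insert.prems(1) by auto
  define e where "e = b - b0"
  have b: "b \<in> V" "b0 \<in> V"
    using b0(1) sB insert.prems(1) by auto
  then have e: "e \<in> V" "\<forall>z\<in>span B. q e z = 0"
    using b0 V by (simp_all add: e_def subspace_diff)
  have eB: "e \<in> span (insert b B)"
    using b0(1) span_mono[of B "insert b B"] by (auto simp: e_def intro!: span_diff intro: span_base)
  obtain y0 where y0: "y0 \<in> span B" "\<forall>z\<in>span B. q (y - y0) z = 0"
    using IH[of y] insert.prems(1,3) by auto
  define w where "w = y - y0"
  have y0V: "y0 \<in> V"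
    using y0(1) sB by auto
  have w: "w \<in> V" "\<forall>z\<in>span B. q w z = 0"
    using y0 y0V V insert.prems(3) by (simp_all add: w_def subspace_diff)
  \<comment> \<open>If \<open>b\<close> already lies in the span of \<open>B\<close>, then \<open>e = 0\<close> and the quotient is 0, a valid coefficient.\<close>
  define r where "r = q w e / q e e"
  have r: "q w e = r * q e e"
  proof (cases "e = 0")
    case True
    have "q w 0 = 0"
      using scale[of 0 w 0] sym[of w 0] w(1) V by (simp add: subspace_0)
    moreover have "q 0 0 = 0"
      using scale[of 0 0 0] V by (simp add: subspace_0)
    ultimately show ?thesis
      using True by simp
  next
    case False
    then have "q e e > 0"
      using insert.prems(2) eB by blast
    then show ?thesis
      by (simp add: r_def)
  qed
  show ?case
  proof (intro bexI[of _ "y0 + r *\<^sub>R e"] ballI)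
    show "y0 + r *\<^sub>R e \<in> span (insert b B)"
      using y0(1) eB span_mono[of B "insert b B"] by (intro span_add span_scale) auto
    fix z assume "z \<in> span (insert b B)"
    then obtain k where k: "z - k *\<^sub>R b \<in> span B"
      by (auto simp: span_insert)
    define u where "u = (z - k *\<^sub>R b) + k *\<^sub>R b0"
    have u: "u \<in> span B"
      unfolding u_def by (intro span_add k span_scale b0(1))
    have z: "z = u + k *\<^sub>R e"
      by (simp add: u_def e_def algebra_simps)
    have uV: "u \<in> V"
      using u sB by auto
    have eq: "y - (y0 + r *\<^sub>R e) = w - r *\<^sub>R e"
      by (simp add: w_def)
    have V': "w - r *\<^sub>R e \<in> V" "r *\<^sub>R e \<in> V" "k *\<^sub>R e \<in> V"
      using w e V by (simp_all add: subspace_diff subspace_scale)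
    have "q (w - r *\<^sub>R e) u = 0"
      using diff[OF w(1) V'(2) uV] scale[OF e(1) uV] e w u by simp
    moreover have "q (w - r *\<^sub>R e) e = 0"
      using diff[OF w(1) V'(2) e(1)] scale[OF e(1) e(1)] r by simp
    ultimately show "q (y - (y0 + r *\<^sub>R e)) z = 0"
      unfolding eq z using V' uV e(1)
      by (simp add: sym[of "w - r *\<^sub>R e"] add scale subspace_add[OF V])
  qed
qed

text \<open>In the application \<open>q\<close> is the metric at a point, evaluated on vector fields of the nilradical.
  Since the metric is indefinite, \<open>q\<close> may be degenerate on \<open>L\<close>.\<close>

locale pseudo_metric_lie_algebra =
  fixes L :: "'v::real_vector set" and br :: "'v \<Rightarrow> 'v \<Rightarrow> 'v" and q :: "'v \<Rightarrow> 'v \<Rightarrow> real"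
  assumes subspace_L: "subspace L"
    and br_closed: "x \<in> L \<Longrightarrow> y \<in> L \<Longrightarrow> br x y \<in> L"
    and br_add: "x \<in> L \<Longrightarrow> y \<in> L \<Longrightarrow> z \<in> L \<Longrightarrow> br x (y + z) = br x y + br x z"
    and br_scale: "x \<in> L \<Longrightarrow> y \<in> L \<Longrightarrow> br x (r *\<^sub>R y) = r *\<^sub>R br x y"
    and br_swap: "x \<in> L \<Longrightarrow> y \<in> L \<Longrightarrow> br x y = - br y x"
    and jacobi: "x \<in> L \<Longrightarrow> y \<in> L \<Longrightarrow> z \<in> L \<Longrightarrow> br x (br y z) + br y (br z x) + br z (br x y) = 0"
    and q_add: "x \<in> L \<Longrightarrow> y \<in> L \<Longrightarrow> z \<in> L \<Longrightarrow> q (x + y) z = q x z + q y z"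
    and q_scale: "x \<in> L \<Longrightarrow> z \<in> L \<Longrightarrow> q (r *\<^sub>R x) z = r * q x z"
    and q_sym: "x \<in> L \<Longrightarrow> y \<in> L \<Longrightarrow> q x y = q y x"
begin

definition derived where "derived = span {br x y | x y. x \<in> L \<and> y \<in> L}"

primrec lcs where
  "lcs 0 = L"
| "lcs (Suc k) = span {br x y | x y. x \<in> L \<and> y \<in> lcs k}"

definition reversing_automorphism where
  "reversing_automorphism \<phi> x \<longleftrightarrow> linear \<phi> \<and> (\<forall>y\<in>L. \<phi> y \<in> L) \<and>
    (\<forall>y\<in>L. \<forall>z\<in>L. \<phi> (br y z) = br (\<phi> y) (\<phi> z) \<and> q (\<phi> y) (\<phi> z) = q y z) \<and> \<phi> x = - x"

lemma lcs_subset: "lcs k \<subseteq> L"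
proof (induction k)
  case (Suc k)
  then show ?case
    unfolding lcs.simps by (intro span_minimal subspace_L) (auto intro: br_closed)
qed simp

lemma subspace_lcs: "subspace (lcs k)"
  by (cases k) (simp_all add: subspace_L)

lemma lcs_1: "lcs (Suc 0) = derived"
  by (simp add: derived_def)

lemma derived_subset: "derived \<subseteq> L"
  using lcs_subset[of "Suc 0"] unfolding lcs_1 .

lemma subspace_derived: "subspace derived"
  by (simp add: derived_def)

lemma br_in_derived: "x \<in> L \<Longrightarrow> y \<in> L \<Longrightarrow> br x y \<in> derived"
  unfolding derived_def by (rule span_base) blast

lemma br_in_lcs: "x \<in> L \<Longrightarrow> y \<in> lcs k \<Longrightarrow> br x y \<in> lcs (Suc k)"
  by (auto intro!: span_base)

lemma br_zero: "x \<in> L \<Longrightarrow> br x 0 = 0"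
  using br_scale[of x 0 0] by (simp add: subspace_0 subspace_L)

lemma br_add_left: "x \<in> L \<Longrightarrow> y \<in> L \<Longrightarrow> z \<in> L \<Longrightarrow> br (x + y) z = br x z + br y z"
  using br_swap[of "x + y" z] br_swap[of x z] br_swap[of y z] br_add[of z x y]
  by (simp add: subspace_add subspace_L)

lemma br_scale_left: "x \<in> L \<Longrightarrow> y \<in> L \<Longrightarrow> br (r *\<^sub>R x) y = r *\<^sub>R br x y"
  using br_swap[of "r *\<^sub>R x" y] br_swap[of x y] br_scale[of y x r]
  by (simp add: subspace_scale subspace_L)

lemma lcs_Suc_trivial:
  assumes "lcs k = {0}"
  shows "lcs (Suc k) \<subseteq> {0}"
proof -
  have "{br x y | x y. x \<in> L \<and> y \<in> lcs k} \<subseteq> {0}"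
    using assms br_zero by auto
  then show ?thesis
    unfolding lcs.simps by (intro span_minimal subspace_single_0)
qed

lemma q_add_right: "x \<in> L \<Longrightarrow> y \<in> L \<Longrightarrow> z \<in> L \<Longrightarrow> q x (y + z) = q x y + q x z"
  using q_add q_sym by (simp add: subspace_add subspace_L)

lemma q_minus: "x \<in> L \<Longrightarrow> y \<in> L \<Longrightarrow> q (- x) y = - q x y"
  using q_scale[of x y "- 1"] by simp

lemma q_minus_right: "x \<in> L \<Longrightarrow> y \<in> L \<Longrightarrow> q x (- y) = - q x y"
  using q_minus[of y x] q_sym by (simp add: subspace_neg subspace_L)

lemma q_zero: "x \<in> L \<Longrightarrow> q 0 x = 0"
  using q_scale[of 0 x 0] by (simp add: subspace_0 subspace_L)

lemma reversing_automorphism_derived: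
  assumes "reversing_automorphism \<phi> x" "y \<in> derived"
  shows "\<phi> y \<in> derived"
proof -
  have \<phi>: "linear \<phi>"
    using assms(1) by (simp add: reversing_automorphism_def)
  have "\<phi> ` derived = span (\<phi> ` {br x y | x y. x \<in> L \<and> y \<in> L})"
    unfolding derived_def by (rule linear_span_image[OF \<phi>, symmetric])
  also have "\<dots> \<subseteq> derived"
  proof (intro span_minimal subspace_derived subsetI)
    fix z assume "z \<in> \<phi> ` {br x y | x y. x \<in> L \<and> y \<in> L}"
    then obtain x y where "x \<in> L" "y \<in> L" "z = \<phi> (br x y)"
      by blast
    then show "z \<in> derived"
      using assms(1) br_in_derived unfolding reversing_automorphism_def by simp
  qed
  finally show ?thesis
    using assms(2) by blast
qed

text \<open>An automorphism reversing \<open>x + y\<close>, with \<open>x\<close> in the derived algebra and \<open>y\<close> orthogonal to it,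
  reverses \<open>x\<close> and \<open>y\<close> separately, and then fixes \<open>[y, x]\<close> while it reverses \<open>x\<close>. Preserving \<open>q\<close>, it
  forces \<open>q [y, x] x = 0\<close>.\<close>

lemma bracket_orthogonal_of_reversing:
  assumes rev: "reversing_automorphism \<phi> (x + y)"
    and pos: "\<And>z. z \<in> derived \<Longrightarrow> z \<noteq> 0 \<Longrightarrow> q z z > 0"
    and x: "x \<in> derived" and y: "y \<in> L" "\<And>z. z \<in> derived \<Longrightarrow> q y z = 0"
  shows "q (br y x) x = 0"
proof -
  have lin: "linear \<phi>" and map: "\<And>z. z \<in> L \<Longrightarrow> \<phi> z \<in> L"
    and br: "\<And>z w. z \<in> L \<Longrightarrow> w \<in> L \<Longrightarrow> \<phi> (br z w) = br (\<phi> z) (\<phi> w)"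
    and iso: "\<And>z w. z \<in> L \<Longrightarrow> w \<in> L \<Longrightarrow> q (\<phi> z) (\<phi> w) = q z w"
    and xy: "\<phi> (x + y) = - (x + y)"
    using rev by (auto simp: reversing_automorphism_def)
  have L: "x \<in> L" "y \<in> L" "\<phi> x \<in> L" "\<phi> y \<in> L"
    using x y derived_subset map by auto
  have \<phi>x: "\<phi> x \<in> derived"
    using reversing_automorphism_derived[OF rev x] .
  define d where "d = \<phi> x + x"
  have d: "d \<in> derived" "d \<in> L"
    using x \<phi>x subspace_derived derived_subset by (auto simp: d_def subspace_add)
  have \<phi>y: "\<phi> y = - (y + d)"
    using xy by (simp add: linear_add[OF lin] d_def algebra_simps add_eq_0_iff)
  \<comment> \<open>Both summands of \<open>q d d = q d (\<phi> x) + q d x\<close> vanish: the first because \<open>\<phi> y = - (y + d)\<close> and \<open>y\<close>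
      are orthogonal to \<open>\<phi> x\<close>, the second because it equals the first, \<open>\<phi>\<close> being an isometry.\<close>
  have "q (\<phi> y) (\<phi> x) = 0"
    using iso[of y x] L y(2)[OF x] by simp
  then have "q d (\<phi> x) = 0"
    using y(2)[OF \<phi>x] L d by (simp add: \<phi>y q_minus q_add subspace_add[OF subspace_L] del: minus_add_distrib)
  moreover have "q d x = q d (\<phi> x)"
    using iso[of x x] L q_sym[of x "\<phi> x"] by (simp add: d_def q_add)
  ultimately have "q d d = 0"
    using q_add_right[OF d(2) L(3) L(1)] by (simp add: d_def)
  then have "d = 0"
    using pos[OF d(1)] by force
  then have "\<phi> x = - x" "\<phi> y = - y"
    using \<phi>y by (simp_all add: d_def eq_neg_iff_add_eq_0)
  moreover have "br (- y) (- x) = br y x"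
    using br_scale_left[of y "- x" "- 1"] br_scale[of y x "- 1"] L by (simp add: subspace_neg subspace_L)
  ultimately have "q (br y x) (- x) = q (br y x) x"
    using br[of y x] iso[of "br y x" x] L br_closed by simp
  then show ?thesis
    using q_minus_right[of "br y x" x] L br_closed by simp
qed

text \<open>On the derived algebra \<open>br y\<close> is skew, so \<open>q (br y z) (br y z) = - q z (br y (br y z))\<close>, and definiteness
  makes the kernels of \<open>br y\<close> and of its square coincide. A nilpotent operator with this property is
  zero.\<close>

lemma skew_nilpotent_eq_zero:
  assumes pos: "\<And>z. z \<in> derived \<Longrightarrow> z \<noteq> 0 \<Longrightarrow> q z z > 0"
    and y: "y \<in> L" and skew: "\<And>x. x \<in> derived \<Longrightarrow> q (br y x) x = 0"
    and nil: "lcs k = {0}" and x: "x \<in> derived"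
  shows "br y x = 0"
proof -
  have cl: "br y z \<in> derived" if "z \<in> derived" for z
    using that y derived_subset br_in_derived by blast
  have inj: "br y z = 0" if z: "z \<in> derived" and "br y (br y z) = 0" for z
  proof -
    let ?w = "br y z"
    have L: "z \<in> L" "?w \<in> L" "br y ?w \<in> L"
      using z cl derived_subset by blast+
    have "q (br y (z + ?w)) (z + ?w) = 0"
      using z cl subspace_derived by (intro skew) (simp add: subspace_add)
    then have "q ?w ?w = 0"
      using L y that skew[OF z] by (simp add: br_add q_add_right)
    then show ?thesis
      using pos[OF cl[OF z]] by force
  qed
  have iter: "(br y ^^ j) z \<in> derived \<and> (br y ^^ j) z \<in> lcs (Suc j)" if "z \<in> derived" for j z
  proof (induction j)
    case 0
    then show ?case
      using that lcs_1 by simp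
  next
    case (Suc j)
    then show ?case
      using cl br_in_lcs[OF y] by (simp del: lcs.simps)
  qed
  have "br y z = 0" if "z \<in> derived" "(br y ^^ Suc j) z = 0" for j z
    using that
  proof (induction j)
    case (Suc j)
    then have "br y ((br y ^^ j) z) = 0"
      using iter[of z j] inj[of "(br y ^^ j) z"] by simp
    then show ?case
      using Suc by simp
  qed simp
  moreover have "(br y ^^ Suc k) x = 0"
  proof -
    have "(br y ^^ k) x \<in> lcs (Suc k)"
      using iter[OF x] by blast
    then have "(br y ^^ k) x = 0"
      using lcs_Suc_trivial[OF nil] by blast
    then show ?thesis
      using y by (simp add: br_zero)
  qed
  ultimately show ?thesis
    using x by blast
qed

text \<open>The centralizer \<open>C\<close> of the derived algebra is a subalgebra by the Jacobi identity, and by the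
  two preceding lemmas it contains the orthogonal complement of the derived algebra. A subalgebra
  that spans \<open>L\<close> together with the derived algebra is all of the nilpotent algebra \<open>L\<close>: the equation
  \<open>L = C + lcs k\<close> passes from \<open>k\<close> to \<open>k + 1\<close>, because the bracket of \<open>c + d\<close> and \<open>c' + d'\<close> has no
  mixed terms.\<close>

theorem two_step_nilpotent:
  assumes nil: "lcs K = {0}"
    and fin: "finite B" "derived \<subseteq> span B"
    and pos: "\<And>z. z \<in> derived \<Longrightarrow> z \<noteq> 0 \<Longrightarrow> q z z > 0"
    and rev: "\<And>x. x \<in> L \<Longrightarrow> x \<noteq> 0 \<Longrightarrow> \<exists>\<phi>. reversing_automorphism \<phi> x"
    and "x \<in> L" "y \<in> derived"
  shows "br x y = 0"
proof -
  define C where "C = {x \<in> L. \<forall>y\<in>derived. br x y = 0}"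
  obtain B' where B': "B' \<subseteq> derived" "independent B'" "derived \<subseteq> span B'"
    by (rule maximal_independent_subset)
  then have B'': "finite B'" "span B' = derived"
    using independent_span_bound[OF fin(1) B'(2)] fin(2) span_minimal[OF B'(1) subspace_derived] by auto
  have perp: "y \<in> C" if y: "y \<in> L" "\<And>z. z \<in> derived \<Longrightarrow> q y z = 0" for y
  proof -
    have "q (br y x) x = 0" if x: "x \<in> derived" for x
    proof (cases "x + y = 0")
      case True
      then have "y = - x"
        by (simp add: add_eq_0_iff)
      then have "y \<in> derived"
        using x subspace_derived by (simp add: subspace_neg)
      then have "y = 0"
        using pos[of y] y(2) by force
      then have "x = 0" "br y x = 0"
        using True br_zero subspace_L by (simp_all add: subspace_0)
      then show ?thesis
        using q_zero y by (simp add: \<open>y = 0\<close>)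
    next
      case False
      then obtain \<phi> where "reversing_automorphism \<phi> (x + y)"
        using rev x y(1) derived_subset subspace_L subspace_add by (metis subsetD)
      then show ?thesis
        using bracket_orthogonal_of_reversing pos x y by blast
    qed
    then show ?thesis
      using skew_nilpotent_eq_zero[OF pos y(1) _ nil] y(1) by (simp add: C_def)
  qed
  have split: "\<exists>c\<in>C. \<exists>d\<in>derived. x = c + d" if x: "x \<in> L" for x
  proof -
    obtain d where d: "d \<in> derived" "\<forall>z\<in>derived. q (x - d) z = 0"
      using orthogonal_projection_finite_span[of L q B' x, unfolded B'', OF subspace_L q_add q_scale q_sym]
        B'(1) B'' derived_subset pos x by auto
    then have "x - d \<in> C"
      using x derived_subset subspace_L by (intro perp) (auto simp: subspace_diff)
    then show ?thesis
      using d(1) by (intro bexI[of _ "x - d"] bexI[of _ d]) auto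
  qed
  have C: "subspace C"
    unfolding subspace_def C_def using subspace_L derived_subset
    by (auto simp: subspace_0 subspace_add subspace_scale br_add_left br_scale_left subset_iff)
      (metis br_swap br_zero neg_equal_0_iff_equal subspace_0)
  have C_br: "br c c' \<in> C" if c: "c \<in> C" "c' \<in> C" for c c'
  proof -
    have L: "c \<in> L" "c' \<in> L"
      using c by (auto simp: C_def)
    have "br (br c c') z = 0" if z: "z \<in> derived" for z
    proof -
      have zL: "z \<in> L"
        using z derived_subset by blast
      have "br c' z = 0" "br c z = 0" "br z c = 0"
        using c z br_swap[OF zL L(1)] by (auto simp: C_def)
      then have "br z (br c c') = 0"
        using jacobi[OF L zL] L br_zero by simp
      then show ?thesis
        using br_swap[OF br_closed[OF L] zL] by simp
    qed
    then show ?thesis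
      using L br_closed by (simp add: C_def)
  qed
  have "\<forall>x\<in>L. \<exists>c\<in>C. \<exists>d\<in>lcs (Suc k). x = c + d" for k
  proof (induction k)
    case 0
    then show ?case
      using split unfolding lcs_1 by blast
  next
    case (Suc k)
    define S where "S = {c + d | c d. c \<in> C \<and> d \<in> lcs (Suc (Suc k))}"
    have S: "subspace S"
      unfolding S_def by (rule subspace_sums[OF C subspace_lcs])
    have "br x y \<in> S" if xy: "x \<in> L" "y \<in> L" for x y
    proof -
      obtain c d where cd: "c \<in> C" "d \<in> derived" "x = c + d"
        using split[OF xy(1)] by blast
      obtain c' d' where cd': "c' \<in> C" "d' \<in> lcs (Suc k)" "y = c' + d'"
        using Suc xy(2) by blast
      have L: "c \<in> L" "d \<in> L" "c' \<in> L" "d' \<in> L"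
        using cd cd' lcs_subset derived_subset C_def by blast+
      have "d' \<in> derived"
      proof -
        have "lcs (Suc k) \<subseteq> derived"
          unfolding lcs.simps using lcs_subset
          by (intro span_minimal subspace_derived) (auto intro: br_in_derived)
        then show ?thesis
          using cd' by blast
      qed
      then have "br c d' = 0" "br d c' = 0"
        using cd cd' br_swap[OF L(2,3)] by (auto simp: C_def)
      then have "br x y = br c c' + br d d'"
        using L by (simp add: cd cd' br_add br_add_left subspace_add[OF subspace_L])
      moreover have "br d d' \<in> lcs (Suc (Suc k))"
        using br_in_lcs[OF L(2) cd'(2)] .
      ultimately show ?thesis
        using C_br[OF cd(1) cd'(1)] by (auto simp: S_def)
    qed
    then have "derived \<subseteq> S"
      unfolding derived_def using S by (intro span_minimal) auto
    show ?case
    proof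
      fix x assume "x \<in> L"
      then obtain c d where cd: "c \<in> C" "d \<in> derived" "x = c + d"
        using split by blast
      then obtain c' d' where "c' \<in> C" "d' \<in> lcs (Suc (Suc k))" "d = c' + d'"
        using \<open>derived \<subseteq> S\<close> by (auto simp: S_def simp del: lcs.simps)
      then show "\<exists>c\<in>C. \<exists>d\<in>lcs (Suc (Suc k)). x = c + d"
        using cd C subspace_add by (metis add.assoc)
    qed
  qed
  then obtain c d where "c \<in> C" "d \<in> lcs (Suc K)" "x = c + d"
    using \<open>x \<in> L\<close> by blast
  then have "x \<in> C"
    using lcs_Suc_trivial[OF nil] by auto
  then show ?thesis
    using \<open>y \<in> derived\<close> by (simp add: C_def)
qed

end

section \<open>The nilradical of a weakly symmetric space\<close>

theorem theorem4p12:
  fixes A :: "('m::{t2_space, second_countable_topology}, 'e::euclidean_space) chart set"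
    and g :: "'m metric" and p :: 'm
    and G H N :: "('m \<Rightarrow> 'm) set"
    and \<gg> \<hh> \<nn> \<mm> :: "'m vector_field set"
  assumes "pseudo_riemannian A g"
    and "connected (UNIV :: 'm set)"
    and "weakly_symmetric A g"
    and "G = isometry_identity_component A g"
    and "is_nilradical A G N"
    and "H = isotropy_subgroup G p"
    and "\<gg> = lie_algebra A G" and "\<hh> = lie_algebra A H" and "\<nn> = lie_algebra A N"
    and "subspace \<mm>" and "\<gg> = {X + Y | X Y. X \<in> \<mm> \<and> Y \<in> \<hh>}" and "\<mm> \<inter> \<hh> = {0}"
    and "\<forall>\<phi>\<in>H. \<forall>X\<in>\<mm>. pushforward A \<phi> X \<in> \<mm>"
    and "\<nn> \<subseteq> \<mm>"
    and "(\<forall>X\<in>bracket_space A \<nn> \<nn>. X \<noteq> 0 \<longrightarrow> g p (X p) (X p) > 0) \<or>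
         (\<forall>X\<in>bracket_space A \<nn> \<nn>. X \<noteq> 0 \<longrightarrow> g p (X p) (X p) < 0)"
  shows "bracket_space A \<nn> (bracket_space A \<nn> \<nn>) = {0}"
proof -
  have atlas: "smooth_atlas A"
    and g_add: "\<And>u v w a b. u \<in> tangent_space A p \<Longrightarrow> v \<in> tangent_space A p \<Longrightarrow>
      w \<in> tangent_space A p \<Longrightarrow> g p (a *\<^sub>R u + b *\<^sub>R v) w = a * g p u w + b * g p v w"
    and g_sym: "\<And>u v. u \<in> tangent_space A p \<Longrightarrow> v \<in> tangent_space A p \<Longrightarrow> g p u v = g p v u"
    using assms(1) by (auto simp: pseudo_riemannian_def)
  interpret manifold A
    by standard (rule atlas)
  have nn_sub: "lie_subalgebra A \<nn>" and nn_nil: "nilpotent_lie_algebra A \<nn>"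
    using assms(5) by (auto simp: assms(9) is_nilradical_def connected_nilpotent_normal_def
        connected_lie_subgroup_def)
  have vf: "X \<in> smooth_vector_fields A" if "X \<in> \<nn>" for X
    using that lie_algebra_vector_field assms(9) by blast
  have tan: "X p \<in> tangent_space A p" if "X \<in> \<nn>" for X
    using vector_field_tangent[OF vf[OF that]] .
  have nn_subspace: "subspace \<nn>"
    using nn_sub by (simp add: lie_subalgebra_def)
  have G_diffeo: "diffeomorphism A \<phi>" if "\<phi> \<in> G" for \<phi>
    using that identity_component_subset isometry_diffeomorphism unfolding assms(4) by blast
  \<comment> \<open>A field of \<open>\<nn>\<close> that vanishes at \<open>p\<close> belongs to \<open>\<hh>\<close>, and \<open>\<nn>\<close> meets \<open>\<hh>\<close> in 0 only.\<close>
  have eval_inj: "X = 0" if X: "X \<in> \<nn>" "X p = 0" for X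
  proof -
    have "X + 0 \<in> \<gg>"
      unfolding assms(11) using X(1) assms(12,14) by blast
    then have "X \<in> \<hh>"
      unfolding assms(6,8) using isotropy_lie_algebra_of_zero[OF G_diffeo] X(2) assms(7) by simp
    then show ?thesis
      using X(1) assms(12,14) by blast
  qed
  \<comment> \<open>The sign \<open>\<epsilon>\<close> turns the negative definite case into the positive definite one.\<close>
  obtain \<epsilon> :: real where \<epsilon>: "\<And>X. X \<in> bracket_space A \<nn> \<nn> \<Longrightarrow> X \<noteq> 0 \<Longrightarrow> \<epsilon> * g p (X p) (X p) > 0"
  proof (cases "\<forall>X\<in>bracket_space A \<nn> \<nn>. X \<noteq> 0 \<longrightarrow> g p (X p) (X p) > 0")
    case True
    then show ?thesis
      using that[of 1] by simp
  next
    case False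
    then show ?thesis
      using that[of "- 1"] assms(15) by fastforce
  qed
  interpret N: pseudo_metric_lie_algebra \<nn> "lie_bracket A" "\<lambda>X Y. \<epsilon> * g p (X p) (Y p)"
  proof
    fix X Y Z r
    assume X: "X \<in> \<nn>" and Z: "Z \<in> \<nn>"
    show "\<epsilon> * g p ((r *\<^sub>R X) p) (Z p) = r * (\<epsilon> * g p (X p) (Z p))"
      using g_add[OF tan[OF X] tan[OF X] tan[OF Z], of r 0] by simp
  next
    fix X Y Z
    assume X: "X \<in> \<nn>" and Y: "Y \<in> \<nn>" and Z: "Z \<in> \<nn>"
    show "\<epsilon> * g p ((X + Y) p) (Z p) = \<epsilon> * g p (X p) (Z p) + \<epsilon> * g p (Y p) (Z p)"
      using g_add[OF tan[OF X] tan[OF Y] tan[OF Z], of 1 1] by (simp add: distrib_left)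
    show "lie_bracket A X (lie_bracket A Y Z) + lie_bracket A Y (lie_bracket A Z X)
        + lie_bracket A Z (lie_bracket A X Y) = 0"
      using X Y Z by (intro lie_bracket_jacobi vf)
    show "lie_bracket A X (Y + Z) = lie_bracket A X Y + lie_bracket A X Z"
      using X Y Z by (intro lie_bracket_add_right vf)
  next
    fix X Y r
    assume "X \<in> \<nn>" "Y \<in> \<nn>"
    then show "lie_bracket A X (r *\<^sub>R Y) = r *\<^sub>R lie_bracket A X Y"
      by (intro lie_bracket_scale_right vf)
  next
    fix X Y
    assume X: "X \<in> \<nn>" and Y: "Y \<in> \<nn>"
    show "\<epsilon> * g p (X p) (Y p) = \<epsilon> * g p (Y p) (X p)"
      using g_sym[OF tan[OF X] tan[OF Y]] by simp
    show "lie_bracket A X Y \<in> \<nn>"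
      using nn_sub X Y by (simp add: lie_subalgebra_def)
    show "lie_bracket A X Y = - lie_bracket A Y X"
      by (rule lie_bracket_swap)
  qed (rule nn_subspace)
  have derived: "N.derived = bracket_space A \<nn> \<nn>"
    by (simp add: N.derived_def bracket_space_def)
  have lcs: "N.lcs k = lower_central_series A \<nn> k" for k
    by (induction k) (simp_all add: bracket_space_def)
  obtain K where K: "N.lcs K = {0}"
    using nn_nil by (auto simp: nilpotent_lie_algebra_def lcs)
  \<comment> \<open>Evaluation at \<open>p\<close> embeds \<open>\<nn>\<close> into the tangent space, so \<open>\<nn>\<close> is finite-dimensional.\<close>
  have fin: "\<exists>B. finite B \<and> N.derived \<subseteq> span B"
  proof -
    obtain B where B: "B \<subseteq> \<nn>" "independent B" "\<nn> \<subseteq> span B"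
      by (rule maximal_independent_subset)
    have sB: "span B \<subseteq> \<nn>"
      using B(1) nn_subspace by (rule span_minimal)
    let ?ev = "\<lambda>X :: 'm vector_field. X p"
    have ev: "linear ?ev"
      by (rule linearI) simp_all
    have inj: "inj_on ?ev (span B)"
    proof (rule inj_onI)
      fix X Y assume "X \<in> span B" "Y \<in> span B" "X p = Y p"
      then show "X = Y"
        using eval_inj[of "X - Y"] sB nn_subspace by (auto simp: subspace_diff subset_iff)
    qed
    obtain T where T: "finite T" "tangent_space A p \<subseteq> span T"
      using tangent_space_finite_span by blast
    have "finite (?ev ` B)"
      using independent_span_bound[OF T(1) linear_independent_injective_image[OF ev B(2) inj]]
        tan B(1) T(2) by blast
    then have "finite B"
      using finite_imageD inj_on_subset[OF inj span_superset] by blast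
    then show ?thesis
      using B(3) N.derived_subset by blast
  qed
  have rev: "\<exists>\<phi>. N.reversing_automorphism \<phi> X" if X: "X \<in> \<nn>" "X \<noteq> 0" for X
  proof -
    have "X p \<noteq> 0"
      using eval_inj X by blast
    then obtain \<phi> where \<phi>: "\<phi> \<in> isometries A g" "\<phi> p = p" "differential A \<phi> p (X p) = - X p"
      using assms(3) tan[OF X(1)] unfolding weakly_symmetric_def by blast
    note diff = isometry_diffeomorphism[OF \<phi>(1)]
    have inv: "inv_into UNIV \<phi> p = p"
      using diffeomorphismD(4)[OF diff, of p] \<phi>(2) by simp
    have push_p: "pushforward A \<phi> Y p = differential A \<phi> p (Y p)" for Y
      by (simp add: pushforward_def inv)
    have push: "pushforward A \<phi> Y \<in> \<nn>" if "Y \<in> \<nn>" for Y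
      using pushforward_nilradical[OF \<phi>(1)] assms(4,5) that unfolding assms(9) by blast
    \<comment> \<open>The isometry reverses \<open>X\<close> only at \<open>p\<close>; since \<open>\<nn>\<close> is invariant, it reverses the whole field.\<close>
    have "pushforward A \<phi> X + X = 0"
    proof (rule eval_inj)
      show "pushforward A \<phi> X + X \<in> \<nn>"
        using push X(1) nn_subspace by (simp add: subspace_add)
    qed (simp add: push_p \<phi>(3))
    then have "pushforward A \<phi> X = - X"
      by (simp add: eq_neg_iff_add_eq_0)
    moreover have "g p (pushforward A \<phi> Y p) (pushforward A \<phi> Z p) = g p (Y p) (Z p)"
      if "Y \<in> \<nn>" "Z \<in> \<nn>" for Y Z
      using \<phi>(1,2) tan that unfolding push_p isometries_def by force
    ultimately show ?thesis
      unfolding N.reversing_automorphism_def using push linear_pushforward pushforward_lie_bracket[OF diff] vf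
      by (intro exI[of _ "pushforward A \<phi>"]) simp
  qed
  have "lie_bracket A X Y = 0" if "X \<in> \<nn>" "Y \<in> bracket_space A \<nn> \<nn>" for X Y
    using N.two_step_nilpotent[OF K] fin \<epsilon> rev that unfolding derived by blast
  then have "{lie_bracket A X Y | X Y. X \<in> \<nn> \<and> Y \<in> bracket_space A \<nn> \<nn>} \<subseteq> {0}"
    by blast
  then have "bracket_space A \<nn> (bracket_space A \<nn> \<nn>) \<subseteq> {0}"
    unfolding bracket_space_def[of A \<nn> "bracket_space A \<nn> \<nn>"] by (intro span_minimal subspace_single_0)
  then show ?thesis
    unfolding bracket_space_def by (auto simp: span_zero)
qed

end
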